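(* Let $\mathbb{F}$ be a field with $\mathrm{char}(\mathbb{F})=0$, $\mathsf{R}=\mathbb{F}[x]$, and $0\neq h\in\mathsf{R}$. Let $\mathsf{V}$ be an irreducible generalized weight $\mathsf{A}_h$-module. Then $\mathsf{V}=\mathsf{V}^{\mathfrak{m}}$ for some maximal ideal $\mathfrak{m}=\mathsf{R}f$ of $\mathsf{R}$ generated by a prime polynomial $f$. (i) If $f$ is a factor of $h$, then $\mathsf{V}=\mathsf{V}_{\mathfrak{m}}$ and $\mathsf{V}\cong\mathsf{L}(\mathfrak{m},\bar g)=\mathsf{U}(\mathfrak{m})/\bar g\,\mathsf{U}(\mathfrak{m})$ for some monic prime polynomial $\bar g\in(\mathsf{R}/\mathfrak{m})[y]$. (ii) If $f$ is not a factor of $h$, then $\mathsf{V}$ is isomorphic to the induced module $\mathsf{U}(\mathfrak{m})=\mathsf{A}_h\otimes_{\mathsf{R}}\mathsf{R}/\mathfrak{m}$.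
   Context: $\mathsf{A}_h$ is the unital associative $\mathbb{F}$-algebra with generators $x,y$ and defining relation $yx=xy+h$; throughout $h\neq 0$. It is a free left and right module over $\mathsf{R}=\mathbb{F}[x]$ with basis $\{y^n\mid n\geq 0\}$. Modules are left modules; "prime polynomial" means irreducible polynomial. For an $\mathsf{A}_h$-module $\mathsf{M}$ and an ideal $\mathfrak{n}$ of $\mathsf{R}$, let $\mathsf{M}_{\mathfrak{n}}=\{v\in\mathsf{M}\mid\mathfrak{n}v=0\}$ and $\mathsf{M}^{\mathfrak{n}}=\{v\in\mathsf{M}\mid\mathfrak{n}^kv=0\text{ for some }k=k(v)\}$. $\mathsf{M}$ is a generalized weight module if $\mathsf{M}=\bigoplus_{\mathfrak{n}}\mathsf{M}^{\mathfrak{n}}$, the sum being over all maximal ideals $\mathfrak{n}$ of $\mathsf{R}$. $(\mathsf{R}/\mathfrak{m})[y]$ is the commutative polynomial ring in $y$. If $\mathfrak{m}=\mathsf{R}f$ with $f$ a prime factor of $h$, and $\bar g=\sum_jy^j\bar g_j\in(\mathsf{R}/\mathfrak{m})[y]$ has lift $g=\sum_jy^jg_j\in\mathsf{A}_h$ ($g_j\in\mathsf{R}$ lifting $\bar g_j$), put $\bar g\,\mathsf{U}(\mathfrak{m}):=\{gw\mid w\in\mathsf{U}(\mathfrak{m})\}$, which is an $\mathsf{A}_h$-submodule depending only on $\bar g$. *)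

theory Defs
  imports
    "HOL-Algebra.Algebra"
    "HOL-Algebra.Algebraic_Closure_Type"
    "HOL-Library.Poly_Mapping"
begin

section \<open>The algebra \<open>A\<^sub>h\<close>\<close>

datatype gen = GenX | GenY

datatype 'g word = Word (letters: "'g list")

text \<open>Words form a monoid, written additively because the convolution product of
  \<^typ>\<open>'a \<Rightarrow>\<^sub>0 'b\<close> requires \<^class>\<open>monoid_add\<close> on the index type. Hence
  \<^typ>\<open>gen word \<Rightarrow>\<^sub>0 'f\<close> is the free unital associative algebra on two generators.\<close>

instantiation word :: (type) monoid_add
begin

definition zero_word :: "'a word" where "zero_word = Word []"

definition plus_word :: "'a word \<Rightarrow> 'a word \<Rightarrow> 'a word"
  where "plus_word u v = Word (letters u @ letters v)"

instance
  by standard (simp_all add: zero_word_def plus_word_def)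

end

type_synonym 'f free_alg = "gen word \<Rightarrow>\<^sub>0 'f"

definition fX :: "'f::field free_alg"
  where "fX = Poly_Mapping.single (Word [GenX]) 1"

definition fY :: "'f::field free_alg"
  where "fY = Poly_Mapping.single (Word [GenY]) 1"

text \<open>The element \<open>p(x)\<close> of the free algebra.\<close>

definition free_poly :: "'f::field poly \<Rightarrow> 'f free_alg"
  where "free_poly p =
    (\<Sum>i\<le>Polynomial.degree p.
       Poly_Mapping.single (Word (replicate i GenX)) (Polynomial.coeff p i))"

definition Ah_ideal :: "'f::field poly \<Rightarrow> 'f free_alg set"
  where "Ah_ideal h =
    Idl\<^bsub>ring_of_type_algebra\<^esub> {fY * fX - (fX * fY + free_poly h)}"

definition Ah :: "'f::field poly \<Rightarrow> 'f free_alg set ring"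
  where "Ah h = ring_of_type_algebra Quot Ah_ideal h"

definition Ah_y :: "'f::field poly \<Rightarrow> 'f free_alg set"
  where "Ah_y h = Ah_ideal h +>\<^bsub>ring_of_type_algebra\<^esub> fY"

definition polyR :: "'f::field poly ring"
  where "polyR = ring_of_type_algebra"

text \<open>The canonical ring homomorphism from \<open>\<F>[x]\<close> to \<open>A\<^sub>h\<close>.\<close>

definition Ah_poly :: "'f::field poly \<Rightarrow> 'f poly \<Rightarrow> 'f free_alg set"
  where "Ah_poly h p = Ah_ideal h +>\<^bsub>ring_of_type_algebra\<^esub> free_poly p"


section \<open>Left modules\<close>

text \<open>The locale \<^locale>\<open>Module.module\<close> requires a commutative base ring. Modules are
  represented by the record type underlying it, whose fields \<open>mult\<close> and \<open>one\<close> are irrelevant.\<close>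

locale left_module = R?: ring R + M?: abelian_group M
  for R :: "('a, 'c) ring_scheme" (structure)
    and M :: "('a, 'b, 'd) module_scheme" (structure) +
  assumes smult_closed:
      "\<lbrakk>a \<in> carrier R; v \<in> carrier M\<rbrakk> \<Longrightarrow> a \<odot>\<^bsub>M\<^esub> v \<in> carrier M"
    and smult_l_distr:
      "\<lbrakk>a \<in> carrier R; b \<in> carrier R; v \<in> carrier M\<rbrakk> \<Longrightarrow>
        (a \<oplus>\<^bsub>R\<^esub> b) \<odot>\<^bsub>M\<^esub> v = a \<odot>\<^bsub>M\<^esub> v \<oplus>\<^bsub>M\<^esub> b \<odot>\<^bsub>M\<^esub> v"
    and smult_r_distr:
      "\<lbrakk>a \<in> carrier R; v \<in> carrier M; w \<in> carrier M\<rbrakk> \<Longrightarrow>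
        a \<odot>\<^bsub>M\<^esub> (v \<oplus>\<^bsub>M\<^esub> w) = a \<odot>\<^bsub>M\<^esub> v \<oplus>\<^bsub>M\<^esub> a \<odot>\<^bsub>M\<^esub> w"
    and smult_assoc:
      "\<lbrakk>a \<in> carrier R; b \<in> carrier R; v \<in> carrier M\<rbrakk> \<Longrightarrow>
        (a \<otimes>\<^bsub>R\<^esub> b) \<odot>\<^bsub>M\<^esub> v = a \<odot>\<^bsub>M\<^esub> (b \<odot>\<^bsub>M\<^esub> v)"
    and smult_one: "v \<in> carrier M \<Longrightarrow> \<one>\<^bsub>R\<^esub> \<odot>\<^bsub>M\<^esub> v = v"

definition irreducible_module ::
    "('a, 'c) ring_scheme \<Rightarrow> ('a, 'b, 'd) module_scheme \<Rightarrow> bool"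
  where "irreducible_module R M \<longleftrightarrow>
    left_module R M \<and> carrier M \<noteq> {\<zero>\<^bsub>M\<^esub>} \<and>
    (\<forall>N. submodule N R M \<longrightarrow> N = {\<zero>\<^bsub>M\<^esub>} \<or> N = carrier M)"

definition module_iso ::
    "('a, 'c) ring_scheme \<Rightarrow> ('a, 'b, 'd) module_scheme \<Rightarrow> ('a, 'e, 'g) module_scheme \<Rightarrow> bool"
  where "module_iso R M N \<longleftrightarrow>
    (\<exists>\<phi>. bij_betw \<phi> (carrier M) (carrier N) \<and>
      (\<forall>v\<in>carrier M. \<forall>w\<in>carrier M. \<phi> (v \<oplus>\<^bsub>M\<^esub> w) = \<phi> v \<oplus>\<^bsub>N\<^esub> \<phi> w) \<and>
      (\<forall>a\<in>carrier R. \<forall>v\<in>carrier M. \<phi> (a \<odot>\<^bsub>M\<^esub> v) = a \<odot>\<^bsub>N\<^esub> \<phi> v))"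

definition regular_module :: "('a, 'c) ring_scheme \<Rightarrow> ('a, 'a) module"
  where "regular_module R =
    \<lparr>carrier = carrier R, monoid.mult = monoid.mult R, one = monoid.one R, ring.zero = ring.zero R, add = add R,
     module.smult = monoid.mult R\<rparr>"

definition quot_module :: "('a, 'b, 'd) module_scheme \<Rightarrow> 'b set \<Rightarrow> ('a, 'b set) module"
  where "quot_module M N =
    \<lparr>carrier = a_rcosets\<^bsub>M\<^esub> N, monoid.mult = undefined, one = undefined,
     ring.zero = N, add = set_add M,
     module.smult = (\<lambda>a C. \<Union>v\<in>C. N +>\<^bsub>M\<^esub> (a \<odot>\<^bsub>M\<^esub> v))\<rparr>"

text \<open>\<open>A \<otimes>\<^sub>R N\<close> for a ring homomorphism \<open>\<phi> : R \<rightarrow> A\<close> and a left \<open>R\<close>-module \<open>N\<close>: the free abelian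
  group on \<open>A \<times> N\<close> modulo the balanced biadditive relations, where \<open>R\<close> acts on \<open>A\<close> from the
  right through \<open>\<phi>\<close>; the ring \<open>A\<close> acts on the first factor from the left.\<close>

definition tensor_rels ::
    "('a, 'c) ring_scheme \<Rightarrow> ('r, 'e) ring_scheme \<Rightarrow> ('r \<Rightarrow> 'a) \<Rightarrow> ('r, 'n, 'd) module_scheme
      \<Rightarrow> ('a \<times> 'n \<Rightarrow>\<^sub>0 int) set"
  where "tensor_rels A R \<phi> N =
    {frag_of (a \<oplus>\<^bsub>A\<^esub> b, n) - frag_of (a, n) - frag_of (b, n) | a b n.
       a \<in> carrier A \<and> b \<in> carrier A \<and> n \<in> carrier N} \<union>
    {frag_of (a, n \<oplus>\<^bsub>N\<^esub> n') - frag_of (a, n) - frag_of (a, n') | a n n'.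
       a \<in> carrier A \<and> n \<in> carrier N \<and> n' \<in> carrier N} \<union>
    {frag_of (a \<otimes>\<^bsub>A\<^esub> \<phi> r, n) - frag_of (a, r \<odot>\<^bsub>N\<^esub> n) | a r n.
       a \<in> carrier A \<and> r \<in> carrier R \<and> n \<in> carrier N}"

definition induced_module ::
    "('a, 'c) ring_scheme \<Rightarrow> ('r, 'e) ring_scheme \<Rightarrow> ('r \<Rightarrow> 'a) \<Rightarrow> ('r, 'n, 'd) module_scheme
      \<Rightarrow> ('a, ('a \<times> 'n \<Rightarrow>\<^sub>0 int) set) module"
  where "induced_module A R \<phi> N =
    (let F = free_Abelian_group (carrier A \<times> carrier N);
         K = generate F (tensor_rels A R \<phi> N)
     in \<lparr>carrier = carrier (F Mod K), monoid.mult = undefined, one = undefined,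
         ring.zero = monoid.one (F Mod K), add = monoid.mult (F Mod K),
         module.smult = (\<lambda>a C. \<Union>c\<in>C. K #>\<^bsub>F\<^esub> frag_extend (\<lambda>(b, n). frag_of (a \<otimes>\<^bsub>A\<^esub> b, n)) c)\<rparr>)"

text \<open>\<open>M\<close> is the internal direct sum of the subsets \<open>W i\<close>, \<open>i \<in> I\<close>: every element has a unique
  decomposition into finitely many nonzero components.\<close>

definition internal_direct_sum ::
    "('a, 'b, 'd) module_scheme \<Rightarrow> 'i set \<Rightarrow> ('i \<Rightarrow> 'b set) \<Rightarrow> bool"
  where "internal_direct_sum M I W \<longleftrightarrow>
    (\<forall>i\<in>I. W i \<subseteq> carrier M) \<and>
    (\<forall>v\<in>carrier M. \<exists>!c.
       (\<forall>i\<in>I. c i \<in> W i) \<and> (\<forall>i. i \<notin> I \<longrightarrow> c i = \<zero>\<^bsub>M\<^esub>) \<and>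
       finite {i. c i \<noteq> \<zero>\<^bsub>M\<^esub>} \<and>
       v = finsum M c {i. c i \<noteq> \<zero>\<^bsub>M\<^esub>})"


section \<open>Generalized weight modules\<close>

primrec ideal_power :: "('a, 'c) ring_scheme \<Rightarrow> 'a set \<Rightarrow> nat \<Rightarrow> 'a set"
  where
    "ideal_power R I 0 = carrier R"
  | "ideal_power R I (Suc k) = ideal_prod R (ideal_power R I k) I"

definition weight_space ::
    "'f::field poly \<Rightarrow> ('f free_alg set, 'v, 'd) module_scheme \<Rightarrow> 'f poly set \<Rightarrow> 'v set"
  where "weight_space h M n =
    {v \<in> carrier M. \<forall>p\<in>n. Ah_poly h p \<odot>\<^bsub>M\<^esub> v = \<zero>\<^bsub>M\<^esub>}"

definition gen_weight_space ::
    "'f::field poly \<Rightarrow> ('f free_alg set, 'v, 'd) module_scheme \<Rightarrow> 'f poly set \<Rightarrow> 'v set"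
  where "gen_weight_space h M n =
    {v \<in> carrier M. \<exists>k. \<forall>p\<in>ideal_power polyR n k. Ah_poly h p \<odot>\<^bsub>M\<^esub> v = \<zero>\<^bsub>M\<^esub>}"

definition generalized_weight_module ::
    "'f::field poly \<Rightarrow> ('f free_alg set, 'v, 'd) module_scheme \<Rightarrow> bool"
  where "generalized_weight_module h M \<longleftrightarrow>
    left_module (Ah h) M \<and>
    internal_direct_sum M {n. maximalideal n polyR} (gen_weight_space h M)"


section \<open>The modules \<open>U(m)\<close> and \<open>L(m, g)\<close>\<close>

type_synonym 'f U_elem = "('f free_alg set \<times> 'f poly set \<Rightarrow>\<^sub>0 int) set"

definition U_module :: "'f::field poly \<Rightarrow> 'f poly set \<Rightarrow> ('f free_alg set, 'f U_elem) module"
  where "U_module h m =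
    induced_module (Ah h) polyR (Ah_poly h) (quot_module (regular_module polyR) m)"

text \<open>A lift \<open>\<Sum>\<^sub>j y\<^sup>j g\<^sub>j\<close> to \<open>A\<^sub>h\<close> of a polynomial over \<open>R/m\<close>. The coefficients \<open>g\<^sub>j\<close> are arbitrary
  representatives; the set \<open>gU_submodule\<close> below does not depend on them when \<open>m\<close> is generated
  by a prime factor of \<open>h\<close>.\<close>

definition poly_lift :: "'f::field poly \<Rightarrow> 'f poly set \<Rightarrow> 'f poly set list \<Rightarrow> 'f free_alg set"
  where "poly_lift h m G =
    finsum (Ah h)
      (\<lambda>j. (Ah_y h [^]\<^bsub>Ah h\<^esub> j) \<otimes>\<^bsub>Ah h\<^esub>
            Ah_poly h (SOME p. p \<in> ring.coeff (polyR Quot m) G j))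
      {..<length G}"

definition gU_submodule :: "'f::field poly \<Rightarrow> 'f poly set \<Rightarrow> 'f poly set list \<Rightarrow> 'f U_elem set"
  where "gU_submodule h m G =
    {poly_lift h m G \<odot>\<^bsub>U_module h m\<^esub> w | w. w \<in> carrier (U_module h m)}"

definition L_module ::
    "'f::field poly \<Rightarrow> 'f poly set \<Rightarrow> 'f poly set list \<Rightarrow> ('f free_alg set, 'f U_elem set) module"
  where "L_module h m G = quot_module (U_module h m) (gU_submodule h m G)"

definition monic_prime_poly :: "('a, 'c) ring_scheme \<Rightarrow> 'a list \<Rightarrow> bool"
  where "monic_prime_poly K G \<longleftrightarrow>
    G \<in> carrier (poly_ring K) \<and> Polynomials.lead_coeff G = \<one>\<^bsub>K\<^esub> \<and>
    pirreducible\<^bsub>K\<^esub> (carrier K) G"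

end

theory Submission
  imports Defs
begin

text \<open>Pick \<open>v \<noteq> 0\<close> in \<open>V\<close> with \<open>f v = 0\<close>; then \<open>V = A\<^sub>h v\<close>, and since \<open>U(m)\<close> is also cyclic, \<open>V\<close> is
  isomorphic to a quotient of \<open>U(m)\<close> as soon as the two annihilators of generators are compared.
  It suffices that the \<open>y\<^sup>j r\<close> span \<open>A\<^sub>h\<close>; their linear independence is never needed.

  If \<open>f\<close> does not divide \<open>h\<close>, then \<open>f\<^sup>n y\<^sup>j r v\<close> vanishes for \<open>j < n\<close> and equals
  \<open>n! (-h f')\<^sup>n r v\<close> for \<open>j = n\<close>. In characteristic \<open>0\<close> this factor is prime to \<open>f\<close>, so
  applying \<open>f\<^sup>n\<close> to a relation \<open>\<Sum>\<^sub>j y\<^sup>j r\<^sub>j v = 0\<close> of degree \<open>n\<close> gives \<open>f | r\<^sub>n\<close>; thus \<open>U(m) \<rightarrow> V\<close> is injective.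

  If \<open>f\<close> divides \<open>h\<close>, then \<open>x\<close> and \<open>y\<close> commute on \<open>V\<close>, which is a simple module over \<open>(R/m)[y]\<close>,
  and the annihilator of \<open>v\<close> is a nonzero prime ideal, generated by the required \<open>g\<close>.\<close>

section \<open>The algebra and its spanning set\<close>

text \<open>The tensor product is a concrete quotient of a free abelian group and awkward to compute
  in, so it is handled only through the surjection a \<mapsto> a \<otimes> 1 from A_h, called
  \<open>\<theta>\<close>. Every isomorphism comes from two surjections out of A_h with equal
  kernels. That a \<otimes> 1 = 0 implies a v = 0 is the universal property of the tensor product;
  it bounds U(m) from below, which is why independence of the y^j r can be avoided. The opposite
  inclusion is where the two cases differ.

  The commutator of y with p is h p', so moving f^k past one y loses at most one factor f.
  Characteristic 0 enters twice: f does not divide f', and n! is a unit.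

  When f divides h, U(m) is killed by f as well, so each a in A_h acts on V and on U(m) by one and
  the same polynomial over R/m, and divisibility by g can be compared on both sides. The annihilator
  of v is nonzero because otherwise y v would generate V, and p y v = v would force p y = 1, making
  y a unit of (R/m)[y].\<close>

lemma ring_ring_of_type_algebra: "ring (ring_of_type_algebra :: 'a::ring_1 ring)"
proof -
  have "\<exists>y. x + y = 0" for x :: 'a
    using add.right_inverse by blast
  thus ?thesis
    unfolding ring_of_type_algebra_def using add.right_inverse
    by unfold_locales (auto simp: algebra_simps Units_def)
qed

lemma ring_of_type_algebra_simps [simp]:
  "carrier ring_of_type_algebra = UNIV"
  "x \<oplus>\<^bsub>ring_of_type_algebra\<^esub> y = x + y"
  "x \<otimes>\<^bsub>ring_of_type_algebra\<^esub> y = x * y"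
  "\<one>\<^bsub>ring_of_type_algebra\<^esub> = 1"
  "\<zero>\<^bsub>ring_of_type_algebra\<^esub> = 0"
  by (simp_all add: ring_of_type_algebra_def)

lemma ring_of_type_algebra_a_inv [simp]:
  "\<ominus>\<^bsub>ring_of_type_algebra\<^esub> x = - (x :: 'a::ring_1)"
proof -
  interpret ring "ring_of_type_algebra :: 'a ring"
    by (rule ring_ring_of_type_algebra)
  show ?thesis
    by (rule minus_equality) auto
qed

text \<open>The residue map itself, of which \<open>Ah_y\<close> and \<open>Ah_poly\<close> are
  values; identities of the free algebra pass through it to A_h.\<close>

definition Ah_proj :: "'f::field poly \<Rightarrow> 'f free_alg \<Rightarrow> 'f free_alg set"
  where "Ah_proj h a = Ah_ideal h +>\<^bsub>ring_of_type_algebra\<^esub> a"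

lemma ideal_Ah_ideal: "ideal (Ah_ideal h) ring_of_type_algebra"
  unfolding Ah_ideal_def
  by (rule ring.genideal_ideal[OF ring_ring_of_type_algebra]) simp

interpretation Ah: ring "Ah h" for h :: "'f::field poly"
  unfolding Ah_def by (rule ideal.quotient_is_ring[OF ideal_Ah_ideal])

lemma Ah_proj_hom: "Ah_proj h \<in> ring_hom ring_of_type_algebra (Ah h)"
  using ideal.rcos_ring_hom[OF ideal_Ah_ideal[of h]] unfolding Ah_def Ah_proj_def[abs_def] .

lemma Ah_proj_closed [simp, intro]: "Ah_proj h a \<in> carrier (Ah h)"
  and Ah_proj_add: "Ah_proj h (a + b) = Ah_proj h a \<oplus>\<^bsub>Ah h\<^esub> Ah_proj h b"
  and Ah_proj_mult: "Ah_proj h (a * b) = Ah_proj h a \<otimes>\<^bsub>Ah h\<^esub> Ah_proj h b"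
  and Ah_proj_one: "Ah_proj h 1 = \<one>\<^bsub>Ah h\<^esub>"
  using Ah_proj_hom[of h] unfolding ring_hom_def by (auto simp: Pi_def)

lemma Ah_proj_zero: "Ah_proj h 0 = \<zero>\<^bsub>Ah h\<^esub>"
  by (metis Ah.add.r_cancel_one Ah_proj_add Ah_proj_closed add_0)

lemma Ah_proj_surj: "a \<in> carrier (Ah h) \<Longrightarrow> \<exists>b. a = Ah_proj h b"
  unfolding Ah_def FactRing_def Ah_proj_def A_RCOSETS_def' by auto

lemma Ah_proj_relation:
  "Ah_proj h (fY * fX) = Ah_proj h (fX * fY + free_poly h)"
proof -
  interpret ring "ring_of_type_algebra :: 'a free_alg ring"
    by (rule ring_ring_of_type_algebra)
  have "fY * fX - (fX * fY + free_poly h) \<in> Ah_ideal h"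
    unfolding Ah_ideal_def by (rule genideal_self') simp
  then show ?thesis
    using quotient_eq_iff_same_a_r_cos[OF ideal_Ah_ideal[of h], of "fY * fX" "fX * fY + free_poly h"]
    unfolding Ah_proj_def by (simp add: a_minus_def algebra_simps)
qed

lemma Ah_y_eq: "Ah_y h = Ah_proj h fY" and Ah_poly_eq: "Ah_poly h p = Ah_proj h (free_poly p)"
  by (simp_all add: Ah_y_def Ah_poly_def Ah_proj_def)

section \<open>Polynomials in x inside the free algebra\<close>

lemma free_poly_eq_sum:
  assumes "Polynomial.degree p \<le> n"
  shows "free_poly p =
    (\<Sum>i\<le>n. Poly_Mapping.single (Word (replicate i GenX)) (Polynomial.coeff p i))"
  unfolding free_poly_def
  by (rule sum.mono_neutral_left) (use assms in \<open>auto simp: Polynomial.coeff_eq_0\<close>)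

lemma free_poly_add: "free_poly (p + q) = free_poly p + free_poly q"
  by (simp add: free_poly_eq_sum[of _ "max (Polynomial.degree p) (Polynomial.degree q)"]
      Polynomial.degree_add_le Poly_Mapping.single_add sum.distrib)

lemma free_poly_pCons: "free_poly (pCons a p) = Poly_Mapping.single 0 a + fX * free_poly p"
proof -
  let ?n = "Polynomial.degree p"
  have "free_poly (pCons a p) = (\<Sum>i\<le>Suc ?n. Poly_Mapping.single (Word (replicate i GenX))
      (Polynomial.coeff (pCons a p) i))"
    by (rule free_poly_eq_sum) (rule Polynomial.degree_pCons_le)
  also have "\<dots> = Poly_Mapping.single 0 a + fX * free_poly p"
    by (simp add: sum.atMost_Suc_shift free_poly_def sum_distrib_left fX_def mult_single
        zero_word_def plus_word_def del: sum.atMost_Suc)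
  finally show ?thesis .
qed

lemma free_poly_0 [simp]: "free_poly 0 = 0"
  by (simp add: free_poly_def)

lemma free_poly_const: "free_poly [:a:] = Poly_Mapping.single 0 a"
  by (simp add: free_poly_pCons)

lemma free_poly_1: "free_poly 1 = 1"
  using free_poly_const[of 1] by (simp add: one_pCons)

lemma free_poly_smult: "free_poly (Polynomial.smult a p) = Poly_Mapping.single 0 a * free_poly p"
  by (simp add: free_poly_eq_sum[of _ "Polynomial.degree p"] Polynomial.degree_smult_le
      sum_distrib_left mult_single)

lemma free_poly_mult: "free_poly (p * q) = free_poly p * free_poly q"
proof (induction p)
  case 0
  show ?case by simp
next
  case (pCons a p)
  then show ?case
    by (simp add: free_poly_add free_poly_smult free_poly_pCons ring_distribs mult.assoc)
qed

lemma Ah_poly_closed [simp, intro]: "Ah_poly h p \<in> carrier (Ah h)"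
  and Ah_y_closed [simp, intro]: "Ah_y h \<in> carrier (Ah h)"
  and Ah_poly_add: "Ah_poly h (p + q) = Ah_poly h p \<oplus>\<^bsub>Ah h\<^esub> Ah_poly h q"
  and Ah_poly_mult: "Ah_poly h (p * q) = Ah_poly h p \<otimes>\<^bsub>Ah h\<^esub> Ah_poly h q"
  and Ah_poly_one: "Ah_poly h 1 = \<one>\<^bsub>Ah h\<^esub>"
  and Ah_poly_zero: "Ah_poly h 0 = \<zero>\<^bsub>Ah h\<^esub>"
  by (simp_all add: Ah_poly_eq Ah_y_eq free_poly_add free_poly_mult free_poly_1
      Ah_proj_add Ah_proj_mult Ah_proj_one Ah_proj_zero)

text \<open>Commutation with y acts on R as the derivation h d/dx. In the induction a polynomial is
  written as a + x p: scalars commute with y, the defining relation handles x, and the Leibniz rule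
  handles the product.\<close>

lemma Ah_y_poly:
  "Ah_y h \<otimes>\<^bsub>Ah h\<^esub> Ah_poly h p =
    Ah_poly h p \<otimes>\<^bsub>Ah h\<^esub> Ah_y h \<oplus>\<^bsub>Ah h\<^esub> Ah_poly h (h * pderiv p)"
proof (induction p)
  case 0
  show ?case by (simp add: Ah_poly_zero)
next
  case (pCons a p)
  let ?x = "Ah_poly h [:0, 1:]" and ?c = "Ah_poly h [:a:]" and ?y = "Ah_y h"
  let ?p = "Ah_poly h p" and ?h = "Ah_poly h h" and ?d = "Ah_poly h (pderiv p)"
  have x: "?x = Ah_proj h fX"
    by (simp add: Ah_poly_eq free_poly_pCons)
  have yx: "?y \<otimes>\<^bsub>Ah h\<^esub> ?x = ?x \<otimes>\<^bsub>Ah h\<^esub> ?y \<oplus>\<^bsub>Ah h\<^esub> ?h"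
    unfolding x using Ah_proj_relation[of h] by (simp add: Ah_poly_eq Ah_y_eq Ah_proj_add Ah_proj_mult)
  have yc: "?y \<otimes>\<^bsub>Ah h\<^esub> ?c = ?c \<otimes>\<^bsub>Ah h\<^esub> ?y"
    by (simp add: Ah_poly_eq Ah_y_eq free_poly_const fY_def mult_single flip: Ah_proj_mult)
  \<comment> \<open>The induction hypothesis leaves x h p', while the goal contains h x p'; both
    factors come from the commutative ring R.\<close>
  have xh: "?x \<otimes>\<^bsub>Ah h\<^esub> ?h = ?h \<otimes>\<^bsub>Ah h\<^esub> ?x"
    by (simp add: mult.commute flip: Ah_poly_mult)
  have split: "Ah_poly h (pCons a p) = ?c \<oplus>\<^bsub>Ah h\<^esub> ?x \<otimes>\<^bsub>Ah h\<^esub> ?p"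
    "Ah_poly h (h * pderiv (pCons a p)) =
      ?h \<otimes>\<^bsub>Ah h\<^esub> (?p \<oplus>\<^bsub>Ah h\<^esub> ?x \<otimes>\<^bsub>Ah h\<^esub> ?d)"
    by (simp_all add: pderiv_pCons flip: Ah_poly_mult Ah_poly_add)
  have IH: "?y \<otimes>\<^bsub>Ah h\<^esub> ?p = ?p \<otimes>\<^bsub>Ah h\<^esub> ?y \<oplus>\<^bsub>Ah h\<^esub> ?h \<otimes>\<^bsub>Ah h\<^esub> ?d"
    using pCons.IH by (simp add: Ah_poly_mult)
  have "?y \<otimes>\<^bsub>Ah h\<^esub> (?c \<oplus>\<^bsub>Ah h\<^esub> ?x \<otimes>\<^bsub>Ah h\<^esub> ?p)
      = ?y \<otimes>\<^bsub>Ah h\<^esub> ?c \<oplus>\<^bsub>Ah h\<^esub> (?y \<otimes>\<^bsub>Ah h\<^esub> ?x) \<otimes>\<^bsub>Ah h\<^esub> ?p"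
    by (simp add: Ah.r_distr Ah.m_assoc)
  also have "\<dots> = ?c \<otimes>\<^bsub>Ah h\<^esub> ?y \<oplus>\<^bsub>Ah h\<^esub>
      (?x \<otimes>\<^bsub>Ah h\<^esub> (?y \<otimes>\<^bsub>Ah h\<^esub> ?p) \<oplus>\<^bsub>Ah h\<^esub> ?h \<otimes>\<^bsub>Ah h\<^esub> ?p)"
    by (simp add: yc yx Ah.l_distr Ah.m_assoc)
  also have "\<dots> = (?c \<oplus>\<^bsub>Ah h\<^esub> ?x \<otimes>\<^bsub>Ah h\<^esub> ?p) \<otimes>\<^bsub>Ah h\<^esub> ?y \<oplus>\<^bsub>Ah h\<^esub>
      ?h \<otimes>\<^bsub>Ah h\<^esub> (?p \<oplus>\<^bsub>Ah h\<^esub> ?x \<otimes>\<^bsub>Ah h\<^esub> ?d)"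
    by (simp add: IH Ah.l_distr Ah.r_distr xh Ah.a_ac flip: Ah.m_assoc)
  finally show ?case
    unfolding split .
qed

text \<open>The same rule solved for p y, since in the normal form y^j r the powers of y stand on
  the left.\<close>

lemma Ah_poly_y:
  "Ah_poly h p \<otimes>\<^bsub>Ah h\<^esub> Ah_y h =
    Ah_y h \<otimes>\<^bsub>Ah h\<^esub> Ah_poly h p \<oplus>\<^bsub>Ah h\<^esub> Ah_poly h (- (h * pderiv p))"
proof -
  have "Ah_poly h (h * pderiv p) \<oplus>\<^bsub>Ah h\<^esub> Ah_poly h (- (h * pderiv p)) = \<zero>\<^bsub>Ah h\<^esub>"
    by (metis Ah_poly_add Ah_poly_zero add.right_inverse)
  then show ?thesis
    by (simp add: Ah_y_poly Ah.a_assoc)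
qed

text \<open>Sums built one monomial y^j r at a time, so that additive properties follow by a single
  induction. Exponents may repeat; collecting them is left to \<open>y_comb\<close>.\<close>

inductive_set Ah_span :: "'f::field poly \<Rightarrow> 'f free_alg set set" for h
  where
    zero: "\<zero>\<^bsub>Ah h\<^esub> \<in> Ah_span h"
  | add: "b \<in> Ah_span h \<Longrightarrow>
      (Ah_y h [^]\<^bsub>Ah h\<^esub> (j::nat)) \<otimes>\<^bsub>Ah h\<^esub> Ah_poly h p \<oplus>\<^bsub>Ah h\<^esub> b \<in> Ah_span h"

lemma Ah_span_closed: "b \<in> Ah_span h \<Longrightarrow> b \<in> carrier (Ah h)"
  by (induction rule: Ah_span.induct) auto

lemma Ah_span_add: "b \<in> Ah_span h \<Longrightarrow> c \<in> Ah_span h \<Longrightarrow> b \<oplus>\<^bsub>Ah h\<^esub> c \<in> Ah_span h"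
  by (induction rule: Ah_span.induct) (auto simp: Ah_span_closed Ah.a_assoc intro: Ah_span.add)

lemma Ah_span_monomial: "(Ah_y h [^]\<^bsub>Ah h\<^esub> (j::nat)) \<otimes>\<^bsub>Ah h\<^esub> Ah_poly h p \<in> Ah_span h"
  using Ah_span.add[OF Ah_span.zero, of h j p] by simp

lemma Ah_span_poly: "b \<in> Ah_span h \<Longrightarrow> b \<otimes>\<^bsub>Ah h\<^esub> Ah_poly h q \<in> Ah_span h"
  by (induction rule: Ah_span.induct)
    (auto simp: Ah_span_closed Ah.l_distr Ah.m_assoc intro: Ah_span.intros simp flip: Ah_poly_mult)

text \<open>A trailing y is moved to the left of r at the cost of the term y^j (-h r'), which is
  again a monomial of the allowed form.\<close>

lemma Ah_span_y: "b \<in> Ah_span h \<Longrightarrow> b \<otimes>\<^bsub>Ah h\<^esub> Ah_y h \<in> Ah_span h"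
proof (induction rule: Ah_span.induct)
  case zero
  show ?case by (simp add: Ah_span.zero)
next
  case (add b j p)
  have "(Ah_y h [^]\<^bsub>Ah h\<^esub> j) \<otimes>\<^bsub>Ah h\<^esub> Ah_poly h p \<otimes>\<^bsub>Ah h\<^esub> Ah_y h =
      (Ah_y h [^]\<^bsub>Ah h\<^esub> Suc j) \<otimes>\<^bsub>Ah h\<^esub> Ah_poly h p \<oplus>\<^bsub>Ah h\<^esub>
      (Ah_y h [^]\<^bsub>Ah h\<^esub> j) \<otimes>\<^bsub>Ah h\<^esub> Ah_poly h (- (h * pderiv p))"
    by (simp add: Ah.m_assoc Ah_poly_y Ah.r_distr)
  then have "(Ah_y h [^]\<^bsub>Ah h\<^esub> j) \<otimes>\<^bsub>Ah h\<^esub> Ah_poly h p \<otimes>\<^bsub>Ah h\<^esub> Ah_y h \<in> Ah_span h"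
    by (metis Ah_span_add Ah_span_monomial)
  with add show ?case
    by (simp add: Ah.l_distr Ah_span_closed Ah_span_add)
qed

lemma free_alg_word_snoc:
  "Poly_Mapping.single (Word (w @ [g])) c = Poly_Mapping.single (Word w) c * Poly_Mapping.single (Word [g]) (1::'f::field)"
  by (simp add: mult_single plus_word_def)

text \<open>Words are taken apart from the right, because the span is closed under right
  multiplication by polynomials and by y.\<close>

lemma Ah_proj_word_in_span: "Ah_proj h (Poly_Mapping.single (Word w) c) \<in> Ah_span h"
proof (induction w rule: rev_induct)
  case Nil
  have "Ah_proj h (Poly_Mapping.single (Word []) c) = Ah_poly h [:c:]"
    by (simp add: Ah_poly_eq free_poly_const zero_word_def)
  then show ?case
    using Ah_span_monomial[of h 0 "[:c:]"] by simp
next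
  case (snoc g w)
  have "Ah_proj h (Poly_Mapping.single (Word [GenX]) 1) = Ah_poly h [:0, 1:]"
    by (simp add: Ah_poly_eq free_poly_pCons fX_def)
  moreover have "Ah_proj h (Poly_Mapping.single (Word [GenY]) 1) = Ah_y h"
    by (simp add: Ah_y_eq fY_def)
  ultimately show ?case
    using Ah_span_poly[OF snoc] Ah_span_y[OF snoc]
    by (cases g) (auto simp: free_alg_word_snoc Ah_proj_mult)
qed

lemma carrier_Ah_eq_span: "carrier (Ah h) = Ah_span h"
proof
  have "Ah_proj h a \<in> Ah_span h" for a
  proof (induction a rule: Poly_Mapping.update_induct)
    case const
    show ?case by (simp add: Ah_proj_zero Ah_span.zero)
  next
    case (update f w c)
    have "Poly_Mapping.update w c f = Poly_Mapping.single w c + f"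
      using update(1) by (intro poly_mapping_eqI)
        (auto simp: lookup_update lookup_add lookup_single in_keys_iff)
    moreover have "Ah_proj h (Poly_Mapping.single w c) \<in> Ah_span h"
      using Ah_proj_word_in_span[of h "letters w" c] by simp
    ultimately show ?case
      using update(3) by (simp add: Ah_proj_add Ah_span_add)
  qed
  then show "carrier (Ah h) \<subseteq> Ah_span h"
    using Ah_proj_surj by blast
qed (use Ah_span_closed in blast)

text \<open>Coefficients stand to the right of the powers of y, where they can cross the tensor sign
  or act first on a vector. \<open>poly_lift\<close> has the same shape.\<close>

definition y_comb :: "'f::field poly \<Rightarrow> nat \<Rightarrow> (nat \<Rightarrow> 'f poly) \<Rightarrow> 'f free_alg set"
  where "y_comb h n r =
    finsum (Ah h) (\<lambda>j. (Ah_y h [^]\<^bsub>Ah h\<^esub> j) \<otimes>\<^bsub>Ah h\<^esub> Ah_poly h (r j)) {..<n}"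

lemma y_comb_closed [simp, intro]: "y_comb h n r \<in> carrier (Ah h)"
  unfolding y_comb_def by (rule Ah.finsum_closed) auto

lemma y_comb_0 [simp]: "y_comb h 0 r = \<zero>\<^bsub>Ah h\<^esub>"
  by (simp add: y_comb_def)

lemma y_comb_Suc: "y_comb h (Suc n) r =
    (Ah_y h [^]\<^bsub>Ah h\<^esub> n) \<otimes>\<^bsub>Ah h\<^esub> Ah_poly h (r n) \<oplus>\<^bsub>Ah h\<^esub> y_comb h n r"
  unfolding y_comb_def lessThan_Suc by (subst Ah.finsum_insert) auto

lemma y_comb_cong: "(\<And>j. j < n \<Longrightarrow> r j = s j) \<Longrightarrow> y_comb h n r = y_comb h n s"
  unfolding y_comb_def by (rule Ah.finsum_cong') (simp_all add: Pi_def)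

lemma y_comb_add:
  "y_comb h n (\<lambda>j. r j + s j) = y_comb h n r \<oplus>\<^bsub>Ah h\<^esub> y_comb h n s"
  by (induction n) (simp_all add: y_comb_Suc Ah_poly_add Ah.r_distr Ah.a_ac)

lemma y_comb_pad:
  "n \<le> N \<Longrightarrow> (\<And>j. n \<le> j \<Longrightarrow> j < N \<Longrightarrow> r j = 0) \<Longrightarrow> y_comb h N r = y_comb h n r"
  by (induction N rule: dec_induct) (simp_all add: y_comb_Suc Ah_poly_zero)

lemma y_comb_single:
  "j < n \<Longrightarrow> y_comb h n (\<lambda>i. if i = j then p else 0) =
    (Ah_y h [^]\<^bsub>Ah h\<^esub> j) \<otimes>\<^bsub>Ah h\<^esub> Ah_poly h p"
proof -
  assume "j < n"
  then have "y_comb h n (\<lambda>i. if i = j then p else 0) = y_comb h (Suc j) (\<lambda>i. if i = j then p else 0)"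
    by (intro y_comb_pad) auto
  moreover have "y_comb h j (\<lambda>i. if i = j then p else 0) = \<zero>\<^bsub>Ah h\<^esub>"
    using y_comb_pad[of 0 j "\<lambda>i. if i = j then p else 0" h] by simp
  ultimately show ?thesis by (simp add: y_comb_Suc)
qed

lemma carrier_Ah_y_comb:
  assumes "a \<in> carrier (Ah h)"
  obtains n r where "a = y_comb h n r"
proof -
  have "\<exists>n r. a = y_comb h n r"
    using assms unfolding carrier_Ah_eq_span
  proof (induction rule: Ah_span.induct)
    case zero
    show ?case by (metis y_comb_0)
  next
    case (add b j p)
    then obtain n r where b: "b = y_comb h n r" by blast
    \<comment> \<open>The values of \<open>r\<close> from n on are arbitrary, so they are cut off
      before the range is enlarged to include j.\<close>
    let ?N = "max n (Suc j)" and ?r = "\<lambda>i. if i < n then r i else 0"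
    have "y_comb h ?N ?r = y_comb h n ?r"
      by (rule y_comb_pad) auto
    then have "y_comb h ?N ?r = b"
      using y_comb_cong[of n ?r r h] b by simp
    then have "y_comb h ?N (\<lambda>i. (if i = j then p else 0) + ?r i) =
        (Ah_y h [^]\<^bsub>Ah h\<^esub> j) \<otimes>\<^bsub>Ah h\<^esub> Ah_poly h p \<oplus>\<^bsub>Ah h\<^esub> b"
      by (simp add: y_comb_add y_comb_single)
    then show ?case by (intro exI) (rule sym)
  qed
  with that show thesis by blast
qed

section \<open>Weight spaces\<close>

lemma cring_polyR: "cring (polyR :: 'f::field poly ring)"
  unfolding polyR_def by (rule cring_from_type_algebra)

interpretation polyR: cring "polyR :: 'f::field poly ring"
  by (rule cring_polyR)

lemma polyR_simps [simp]:
  "carrier (polyR :: 'f::field poly ring) = UNIV"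
  "p \<oplus>\<^bsub>polyR\<^esub> q = p + q"
  "p \<otimes>\<^bsub>polyR\<^esub> q = p * q"
  "\<one>\<^bsub>polyR\<^esub> = (1 :: 'f poly)"
  "\<zero>\<^bsub>polyR\<^esub> = (0 :: 'f poly)"
  "\<ominus>\<^bsub>polyR\<^esub> p = - p"
  by (simp_all add: polyR_def)

lemma mem_PIdl_polyR: "p \<in> PIdl\<^bsub>polyR\<^esub> f \<longleftrightarrow> f dvd p"
  unfolding cgenideal_def dvd_def by (auto simp: mult.commute)

lemma ideal_polyR_imp_principal:
  fixes m :: "'f::field poly set"
  assumes "ideal m polyR"
  shows "\<exists>f. m = PIdl\<^bsub>polyR\<^esub> f"
proof (cases "m = {0}")
  case True
  then show ?thesis
    by (intro exI[of _ 0]) (auto simp: mem_PIdl_polyR)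
next
  case False
  interpret ideal m polyR by fact
  have closed: "p * q \<in> m" "p - r \<in> m" if "p \<in> m" "r \<in> m" for p q r
    using that I_r_closed[of p q] a_closed[of p "- r"] a_inv_closed[of r] by simp_all
  obtain g where g: "g \<in> m" "g \<noteq> 0"
    using False zero_closed by auto
  obtain f where f: "f \<in> m" "f \<noteq> 0"
    and min: "\<And>g. g \<in> m \<Longrightarrow> g \<noteq> 0 \<Longrightarrow> Polynomial.degree f \<le> Polynomial.degree g"
    using ex_has_least_nat[of "\<lambda>g. g \<in> m \<and> g \<noteq> 0" g Polynomial.degree] g by auto
  have "f dvd p" if p: "p \<in> m" for p
  proof (rule ccontr)
    assume "\<not> f dvd p"
    then have nz: "p mod f \<noteq> 0" by (simp add: dvd_eq_mod_eq_0)
    have "p mod f \<in> m"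
      using closed(2)[OF p closed(1)[OF f(1) f(1), of "p div f"]] by (simp add: minus_mult_div_eq_mod)
    from min[OF this nz] degree_mod_less[OF f(2), of p] nz show False
      by simp
  qed
  moreover have "p \<in> m" if "f dvd p" for p
    using that closed(1)[OF f(1) f(1)] by (auto elim: dvdE)
  ultimately show ?thesis
    by (intro exI[of _ f] equalityI subsetI) (simp_all only: mem_PIdl_polyR)
qed

text \<open>The ideal generated by f and p strictly contains a maximal ideal, so it is everything.
  This Bezout identity is the form in which maximality is applied to vectors.\<close>

lemma maximalideal_polyR_comaximal:
  fixes f p :: "'f::field poly"
  assumes "maximalideal (PIdl\<^bsub>polyR\<^esub> f) polyR" "\<not> f dvd p"
  obtains a b where "a * f + b * p = 1"
proof -
  interpret maximalideal "PIdl\<^bsub>polyR\<^esub> f" polyR by fact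
  let ?J = "PIdl\<^bsub>polyR\<^esub> f <+>\<^bsub>polyR\<^esub> PIdl\<^bsub>polyR\<^esub> p"
  have J: "ideal ?J polyR"
    by (intro polyR.add_ideals polyR.cgenideal_ideal) auto
  have mem_J: "c \<in> ?J \<longleftrightarrow> (\<exists>a b. f dvd a \<and> p dvd b \<and> c = a + b)" for c
    unfolding set_add_def' polyR_simps using mem_PIdl_polyR by auto
  have "PIdl\<^bsub>polyR\<^esub> f \<subseteq> ?J" "p \<in> ?J"
    unfolding subset_iff mem_J mem_PIdl_polyR by (metis add_0 add_0_right dvd_0_right dvd_refl)+
  moreover have "p \<notin> PIdl\<^bsub>polyR\<^esub> f"
    using assms(2) by (simp add: mem_PIdl_polyR)
  ultimately have "?J = UNIV"
    using I_maximal[OF J] by auto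
  then have "1 \<in> ?J" by simp
  then obtain a b where "f * a + p * b = 1"
    unfolding mem_J by (auto simp: dvd_def)
  then show thesis
    using that by (simp add: mult.commute)
qed

lemma maximalideal_polyR_prime:
  fixes f p q :: "'f::field poly"
  assumes "maximalideal (PIdl\<^bsub>polyR\<^esub> f) polyR" "f dvd p * q"
  shows "f dvd p \<or> f dvd q"
  using polyR.maximalideal_prime[OF assms(1)] primeideal.I_prime[of "PIdl\<^bsub>polyR\<^esub> f" polyR p q] assms(2)
  by (simp add: mem_PIdl_polyR)

lemma maximalideal_polyR_irreducible:
  fixes f :: "'f::field poly"
  assumes "maximalideal (PIdl\<^bsub>polyR\<^esub> f) polyR"
  shows "Factorial_Ring.irreducible f"
proof -
  interpret maximalideal "PIdl\<^bsub>polyR\<^esub> f" polyR by fact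
  have nu: "\<not> f dvd 1"
    using I_notcarr one_imp_carrier by (auto simp: mem_PIdl_polyR)
  \<comment> \<open>The zero ideal is not maximal: it would make x a unit, which evaluation at 0
    refutes.\<close>
  have "f \<noteq> 0"
  proof
    assume "f = 0"
    with nu assms obtain a where "a * [:0, 1:] = (1 :: 'f poly)"
      by (elim maximalideal_polyR_comaximal[where p = "[:0, 1:]"]) auto
    then have "poly (a * [:0, 1:]) 0 = 1"
      by simp
    then show False
      by simp
  qed
  moreover have "a dvd 1 \<or> b dvd 1" if "f = a * b" for a b
  proof -
    have "f dvd a \<or> f dvd b"
      using maximalideal_polyR_prime[OF assms, of a b] that by simp
    then show ?thesis
      using that \<open>f \<noteq> 0\<close> by (auto simp: dvd_def)
  qed
  ultimately show ?thesis
    using nu by (intro Factorial_Ring.irreducibleI) auto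
qed

text \<open>Enough of the equality m^k = R f^k to test a generalized weight vector on the single
  element f^k.\<close>

lemma ideal_power_PIdl:
  "f ^ k \<in> ideal_power polyR (PIdl\<^bsub>polyR\<^esub> f) k"
  "p \<in> ideal_power polyR (PIdl\<^bsub>polyR\<^esub> f) k \<Longrightarrow> f ^ k dvd p"
proof (induction k arbitrary: p)
  case (Suc k)
  {
    case 1
    show ?case
      using ideal_prod.prod[OF Suc(1), of f "PIdl\<^bsub>polyR\<^esub> f" polyR]
      by (simp add: mem_PIdl_polyR mult.commute)
  next
    case 2
    then have "p \<in> ideal_prod polyR (ideal_power polyR (PIdl\<^bsub>polyR\<^esub> f) k) (PIdl\<^bsub>polyR\<^esub> f)"
      by simp
    then show ?case
    proof (induction rule: ideal_prod.induct)
      case (prod i j)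
      then show ?case
        using Suc(2)[of i] mult_dvd_mono[of "f ^ k" i f j]
        by (simp add: mem_PIdl_polyR mult.commute)
    qed simp
  }
qed simp_all

text \<open>The dividend is the correction term that appears when f^(k+1) is moved past y. It keeps
  the factor f^k, so each y costs one power of f.\<close>

lemma power_dvd_pderiv_power_Suc: "f ^ k dvd - (h * pderiv (f ^ Suc k))" for f h :: "'f::field poly"
  unfolding pderiv_power_Suc dvd_minus_iff
  by (intro dvd_mult dvd_mult2 dvd_smult dvd_refl)

section \<open>The action of x and y on an A_h-module\<close>

locale Ah_module = left_module "Ah h" M
  for h :: "'f::field poly" and M :: "('f free_alg set, 'v, 'd) module_scheme" (structure)
begin

abbreviation p_act :: "'f poly \<Rightarrow> 'v \<Rightarrow> 'v"
  where "p_act p v \<equiv> Ah_poly h p \<odot>\<^bsub>M\<^esub> v"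

abbreviation y_act :: "'v \<Rightarrow> 'v"
  where "y_act v \<equiv> Ah_y h \<odot>\<^bsub>M\<^esub> v"

abbreviation y_pow :: "nat \<Rightarrow> 'v \<Rightarrow> 'v"
  where "y_pow j v \<equiv> (Ah_y h [^]\<^bsub>Ah h\<^esub> j) \<odot>\<^bsub>M\<^esub> v"

declare smult_closed [simp, intro]

lemma smult_zero_right [simp]: "a \<in> carrier (Ah h) \<Longrightarrow> a \<odot>\<^bsub>M\<^esub> \<zero>\<^bsub>M\<^esub> = \<zero>\<^bsub>M\<^esub>"
  using smult_r_distr[of a "\<zero>\<^bsub>M\<^esub>" "\<zero>\<^bsub>M\<^esub>"] M.add.r_cancel_one[of "a \<odot>\<^bsub>M\<^esub> \<zero>\<^bsub>M\<^esub>" "a \<odot>\<^bsub>M\<^esub> \<zero>\<^bsub>M\<^esub>"]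
  by simp

lemma smult_zero_left [simp]: "v \<in> carrier M \<Longrightarrow> \<zero>\<^bsub>Ah h\<^esub> \<odot>\<^bsub>M\<^esub> v = \<zero>\<^bsub>M\<^esub>"
  using smult_l_distr[of "\<zero>\<^bsub>Ah h\<^esub>" "\<zero>\<^bsub>Ah h\<^esub>" v]
    M.add.r_cancel_one[of "\<zero>\<^bsub>Ah h\<^esub> \<odot>\<^bsub>M\<^esub> v" "\<zero>\<^bsub>Ah h\<^esub> \<odot>\<^bsub>M\<^esub> v"]
  by simp

lemma p_act_add: "v \<in> carrier M \<Longrightarrow> p_act (p + q) v = p_act p v \<oplus>\<^bsub>M\<^esub> p_act q v"
  by (simp add: Ah_poly_add smult_l_distr)

lemma p_act_mult: "v \<in> carrier M \<Longrightarrow> p_act (p * q) v = p_act p (p_act q v)"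
  by (simp add: Ah_poly_mult smult_assoc)

lemma p_act_one [simp]: "v \<in> carrier M \<Longrightarrow> p_act 1 v = v"
  by (simp add: Ah_poly_one smult_one)

lemma p_act_zero [simp]: "v \<in> carrier M \<Longrightarrow> p_act 0 v = \<zero>\<^bsub>M\<^esub>"
  by (simp add: Ah_poly_zero)

lemma p_act_uminus: "v \<in> carrier M \<Longrightarrow> p_act (- p) v = \<ominus>\<^bsub>M\<^esub> p_act p v"
  using p_act_add[of v "- p" p] by (simp add: M.minus_equality)

lemma p_act_dvd: "v \<in> carrier M \<Longrightarrow> p_act p v = \<zero>\<^bsub>M\<^esub> \<Longrightarrow> p dvd q \<Longrightarrow> p_act q v = \<zero>\<^bsub>M\<^esub>"
  by (auto elim!: dvdE simp: p_act_mult mult.commute[of p])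

lemma p_act_y_act:
  "v \<in> carrier M \<Longrightarrow>
    p_act p (y_act v) = y_act (p_act p v) \<oplus>\<^bsub>M\<^esub> p_act (- (h * pderiv p)) v"
  by (simp add: Ah_poly_y smult_l_distr flip: smult_assoc)

lemma y_pow_Suc: "v \<in> carrier M \<Longrightarrow> y_pow (Suc j) v = y_act (y_pow j v)"
  using Ah.nat_pow_Suc2[of "Ah_y h" h j] by (simp add: smult_assoc del: Ah.nat_pow_Suc)

lemma y_comb_smult_Suc:
  "v \<in> carrier M \<Longrightarrow>
    y_comb h (Suc n) r \<odot>\<^bsub>M\<^esub> v = y_pow n (p_act (r n) v) \<oplus>\<^bsub>M\<^esub> y_comb h n r \<odot>\<^bsub>M\<^esub> v"
  by (simp add: y_comb_Suc smult_l_distr smult_assoc)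

text \<open>The algebra is spanned additively by the y^j r, so stability under R and y suffices;
  additive inverses come from the scalar -1.\<close>

lemma submodule_if_closed:
  assumes sub: "N \<subseteq> carrier M" and zero: "\<zero>\<^bsub>M\<^esub> \<in> N"
    and add: "\<And>v w. v \<in> N \<Longrightarrow> w \<in> N \<Longrightarrow> v \<oplus>\<^bsub>M\<^esub> w \<in> N"
    and p: "\<And>p v. v \<in> N \<Longrightarrow> p_act p v \<in> N"
    and y: "\<And>v. v \<in> N \<Longrightarrow> y_act v \<in> N"
  shows "submodule N (Ah h) M"
proof -
  have minus: "\<ominus>\<^bsub>M\<^esub> v \<in> N" if "v \<in> N" for v
    using p[OF that, of "- 1"] that sub by (simp add: p_act_uminus subset_iff)
  have pow: "y_pow j v \<in> N" if "v \<in> N" for j v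
  proof (induction j)
    case 0
    show ?case using that sub by (auto simp: smult_one)
  next
    case (Suc j)
    have "v \<in> carrier M" using that sub by auto
    with Suc y show ?case by (simp only: y_pow_Suc)
  qed
  have smult: "a \<odot>\<^bsub>M\<^esub> v \<in> N" if "a \<in> carrier (Ah h)" and v: "v \<in> N" for a v
    using that(1) unfolding carrier_Ah_eq_span
  proof (induction rule: Ah_span.induct)
    case zero
    show ?case using v sub assms(2) by (simp add: subset_iff)
  next
    case (add b j q)
    have "v \<in> carrier M" using v sub by auto
    then have "((Ah_y h [^]\<^bsub>Ah h\<^esub> j) \<otimes>\<^bsub>Ah h\<^esub> Ah_poly h q \<oplus>\<^bsub>Ah h\<^esub> b) \<odot>\<^bsub>M\<^esub> v =
        y_pow j (p_act q v) \<oplus>\<^bsub>M\<^esub> b \<odot>\<^bsub>M\<^esub> v"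
      using Ah_span_closed[OF add.hyps] by (simp add: smult_l_distr smult_assoc)
    with add.IH assms(3) pow p v show ?case by simp
  qed
  show ?thesis
    unfolding submodule_def submodule_axioms_def
    by (intro conjI allI impI M.add.subgroupI)
      (use assms(1,2,3) minus smult in \<open>auto simp flip: a_inv_def\<close>)
qed

lemma mem_weight_space:
  "v \<in> weight_space h M (PIdl\<^bsub>polyR\<^esub> f) \<longleftrightarrow> v \<in> carrier M \<and> p_act f v = \<zero>\<^bsub>M\<^esub>"
  unfolding weight_space_def using p_act_dvd[of v f] by (auto simp: mem_PIdl_polyR)

lemma mem_gen_weight_space:
  "v \<in> gen_weight_space h M (PIdl\<^bsub>polyR\<^esub> f) \<longleftrightarrow>
    v \<in> carrier M \<and> (\<exists>k. p_act (f ^ k) v = \<zero>\<^bsub>M\<^esub>)"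
  unfolding gen_weight_space_def
  using ideal_power_PIdl p_act_dvd by (auto simp: Ball_def) blast+

text \<open>If f divides h, the correction term -h f' for moving f past y is a multiple of f, so y
  preserves the vectors killed by f.\<close>

lemma submodule_weight_space:
  assumes "f dvd h"
  shows "submodule (weight_space h M (PIdl\<^bsub>polyR\<^esub> f)) (Ah h) M"
proof (rule submodule_if_closed)
  fix v assume "v \<in> weight_space h M (PIdl\<^bsub>polyR\<^esub> f)"
  then have v: "v \<in> carrier M" "p_act f v = \<zero>\<^bsub>M\<^esub>"
    by (auto simp: mem_weight_space)
  have "p_act (- (h * pderiv f)) v = \<zero>\<^bsub>M\<^esub>"
    using v assms by (simp add: p_act_dvd[of v f])
  then show "y_act v \<in> weight_space h M (PIdl\<^bsub>polyR\<^esub> f)"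
    using v by (simp add: mem_weight_space p_act_y_act)
  fix p
  have "p_act f (p_act p v) = p_act p (p_act f v)"
    using v(1) by (metis mult.commute p_act_mult)
  then show "p_act p v \<in> weight_space h M (PIdl\<^bsub>polyR\<^esub> f)"
    using v by (simp add: mem_weight_space)
qed (auto simp: mem_weight_space smult_r_distr)

text \<open>Moving f^(k+1) past y leaves a correction divisible by f^k, so y raises the exponent by
  at most one, whether or not f divides h.\<close>

lemma submodule_gen_weight_space:
  "submodule (gen_weight_space h M (PIdl\<^bsub>polyR\<^esub> f)) (Ah h) M"
proof (rule submodule_if_closed)
  fix v assume "v \<in> gen_weight_space h M (PIdl\<^bsub>polyR\<^esub> f)"
  then obtain k where v: "v \<in> carrier M" "p_act (f ^ k) v = \<zero>\<^bsub>M\<^esub>"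
    by (auto simp: mem_gen_weight_space)
  have "p_act (- (h * pderiv (f ^ Suc k))) v = \<zero>\<^bsub>M\<^esub>" "p_act (f ^ Suc k) v = \<zero>\<^bsub>M\<^esub>"
    by (rule p_act_dvd[OF v], rule power_dvd_pderiv_power_Suc) (rule p_act_dvd[OF v], simp)
  then have "p_act (f ^ Suc k) (y_act v) = \<zero>\<^bsub>M\<^esub>"
    using v by (simp add: p_act_y_act del: power_Suc)
  then show "y_act v \<in> gen_weight_space h M (PIdl\<^bsub>polyR\<^esub> f)"
    using v unfolding mem_gen_weight_space by blast
  fix p
  have "p_act (f ^ k) (p_act p v) = p_act p (p_act (f ^ k) v)"
    using v(1) by (metis mult.commute p_act_mult)
  then show "p_act p v \<in> gen_weight_space h M (PIdl\<^bsub>polyR\<^esub> f)"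
    using v by (auto simp: mem_gen_weight_space)
next
  fix v w assume vw: "v \<in> gen_weight_space h M (PIdl\<^bsub>polyR\<^esub> f)" "w \<in> gen_weight_space h M (PIdl\<^bsub>polyR\<^esub> f)"
  then obtain k l where "p_act (f ^ k) v = \<zero>\<^bsub>M\<^esub>" "p_act (f ^ l) w = \<zero>\<^bsub>M\<^esub>"
    by (auto simp: mem_gen_weight_space)
  with vw have "p_act (f ^ (k + l)) v = \<zero>\<^bsub>M\<^esub>" "p_act (f ^ (k + l)) w = \<zero>\<^bsub>M\<^esub>"
    using p_act_dvd[of v "f ^ k" "f ^ (k + l)"] p_act_dvd[of w "f ^ l" "f ^ (k + l)"]
    by (simp_all add: power_add mem_gen_weight_space)
  with vw have "p_act (f ^ (k + l)) (v \<oplus>\<^bsub>M\<^esub> w) = \<zero>\<^bsub>M\<^esub>"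
    by (simp add: smult_r_distr mem_gen_weight_space)
  with vw show "v \<oplus>\<^bsub>M\<^esub> w \<in> gen_weight_space h M (PIdl\<^bsub>polyR\<^esub> f)"
    unfolding mem_gen_weight_space by blast
qed (auto simp: mem_gen_weight_space)

text \<open>The last nonzero vector among w, f w, f^2 w, ... is killed by f.\<close>

lemma weight_vector_exists:
  assumes "w \<in> gen_weight_space h M (PIdl\<^bsub>polyR\<^esub> f)" "w \<noteq> \<zero>\<^bsub>M\<^esub>"
  obtains v where "v \<in> carrier M" "v \<noteq> \<zero>\<^bsub>M\<^esub>" "p_act f v = \<zero>\<^bsub>M\<^esub>"
proof -
  define k where "k = (LEAST k. p_act (f ^ k) w = \<zero>\<^bsub>M\<^esub>)"
  have w: "w \<in> carrier M" and "\<exists>k. p_act (f ^ k) w = \<zero>\<^bsub>M\<^esub>"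
    using assms by (auto simp: mem_gen_weight_space)
  then have k: "p_act (f ^ k) w = \<zero>\<^bsub>M\<^esub>"
    unfolding k_def by (auto intro: LeastI)
  then obtain l where l: "k = Suc l"
    using assms(2) w by (cases k) auto
  then have "p_act (f ^ l) w \<noteq> \<zero>\<^bsub>M\<^esub>"
    using not_less_Least[of l "\<lambda>k. p_act (f ^ k) w = \<zero>\<^bsub>M\<^esub>"] by (simp add: k_def)
  moreover have "p_act f (p_act (f ^ l) w) = \<zero>\<^bsub>M\<^esub>"
    using k w by (simp add: l flip: p_act_mult)
  ultimately show thesis
    using that[of "p_act (f ^ l) w"] w by simp
qed

text \<open>The annihilator of v in R contains the maximal ideal of f and misses 1, hence is that
  ideal; concretely, a f + b p = 1 would give v = 0.\<close>

lemma p_act_eq_zero_iff: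
  assumes max: "maximalideal (PIdl\<^bsub>polyR\<^esub> f) polyR"
    and v: "v \<in> carrier M" "v \<noteq> \<zero>\<^bsub>M\<^esub>" "p_act f v = \<zero>\<^bsub>M\<^esub>"
  shows "p_act p v = \<zero>\<^bsub>M\<^esub> \<longleftrightarrow> f dvd p"
proof
  assume p: "p_act p v = \<zero>\<^bsub>M\<^esub>"
  show "f dvd p"
  proof (rule ccontr)
    assume "\<not> f dvd p"
    with max obtain a b where ab: "a * f + b * p = 1"
      by (rule maximalideal_polyR_comaximal)
    have "v = p_act (a * f + b * p) v"
      using v by (simp add: ab)
    then show False
      using v p by (simp add: p_act_add p_act_mult)
  qed
qed (use p_act_dvd v in blast)

text \<open>Each of the j factors y uses up at most one factor f, and k > j of them are present. The
  induction needs the claim at k and at k - 1, hence the generalization over k.\<close>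

lemma power_p_act_y_pow_zero:
  assumes v: "v \<in> carrier M" "p_act f v = \<zero>\<^bsub>M\<^esub>" and "j < k"
  shows "p_act (f ^ k) (y_pow j v) = \<zero>\<^bsub>M\<^esub>"
  using \<open>j < k\<close>
proof (induction j arbitrary: k)
  case 0
  then show ?case
    using v by (cases k) (auto simp: smult_one p_act_mult mult.commute[of f])
next
  case (Suc j)
  then obtain l where l: "k = Suc l" "j < l"
    by (cases k) auto
  have "p_act (- (h * pderiv (f ^ Suc l))) (y_pow j v) = \<zero>\<^bsub>M\<^esub>"
    using v by (intro p_act_dvd[OF _ Suc.IH[OF l(2)]] power_dvd_pderiv_power_Suc) auto
  then show ?case
    using v Suc.IH[of k] l unfolding y_pow_Suc[OF v(1)] by (simp add: p_act_y_act del: power_Suc)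
qed

text \<open>Moving f^(n+1) past one y gives two terms. The one with y in front vanishes by
  \<open>power_p_act_y_pow_zero\<close>; the other is (n + 1)(-h f') f^n y^n v, and iterating it
  produces n!.\<close>

lemma power_p_act_y_pow:
  assumes v: "v \<in> carrier M" "p_act f v = \<zero>\<^bsub>M\<^esub>"
  shows "p_act (f ^ n) (y_pow n v) = p_act (of_nat (fact n) * (- (h * pderiv f)) ^ n) v"
proof (induction n)
  case 0
  show ?case using v by (simp add: smult_one)
next
  case (Suc n)
  have *: "- (h * pderiv (f ^ Suc n)) = (of_nat (Suc n) * (- (h * pderiv f))) * f ^ n"
    by (simp only: pderiv_power_Suc of_nat_poly) (simp add: algebra_simps)
  have "p_act (f ^ Suc n) (y_pow (Suc n) v) =
      p_act (of_nat (Suc n) * (- (h * pderiv f))) (p_act (f ^ n) (y_pow n v))"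
    using v power_p_act_y_pow_zero[OF v, of n "Suc n"]
    unfolding y_pow_Suc[OF v(1)] by (simp add: p_act_y_act *
        del: power_Suc of_nat_Suc flip: p_act_mult)
  also have "\<dots> = p_act (of_nat (fact (Suc n)) * (- (h * pderiv f)) ^ Suc n) v"
    using v unfolding Suc.IH by (simp add: algebra_simps flip: p_act_mult)
  finally show ?case .
qed

text \<open>Once f divides the leading coefficient, its term vanishes on v and the relation gets
  shorter, so the induction on n strips coefficients from the top.\<close>

lemma y_comb_annihilates_imp_dvd:
  assumes char: "CHAR('f) = 0"
    and max: "maximalideal (PIdl\<^bsub>polyR\<^esub> f) polyR"
    and f: "\<not> f dvd h" "\<not> f dvd pderiv f"
    and v: "v \<in> carrier M" "v \<noteq> \<zero>\<^bsub>M\<^esub>" "p_act f v = \<zero>\<^bsub>M\<^esub>"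
  shows "y_comb h n r \<odot>\<^bsub>M\<^esub> v = \<zero>\<^bsub>M\<^esub> \<Longrightarrow> j < n \<Longrightarrow> f dvd r j"
proof (induction n)
  case (Suc n)
  \<comment> \<open>Each r_i v is again killed by f, so the two power lemmas apply with it in place
    of v.\<close>
  have u: "p_act (r i) v \<in> carrier M" "p_act f (p_act (r i) v) = \<zero>\<^bsub>M\<^esub>" for i
    using v by (auto simp: mult.commute[of f] simp flip: p_act_mult) (simp add: p_act_mult)
  have low: "p_act (f ^ n) (y_comb h k r \<odot>\<^bsub>M\<^esub> v) = \<zero>\<^bsub>M\<^esub>" if "k \<le> n" for k
    using that
  proof (induction k)
    case (Suc k)
    then show ?case
      using v u by (simp add: y_comb_smult_Suc smult_r_distr power_p_act_y_pow_zero)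
  qed (use v in simp)
  have "\<zero>\<^bsub>M\<^esub> = p_act (f ^ n) (y_comb h (Suc n) r \<odot>\<^bsub>M\<^esub> v)"
    using Suc.prems by simp
  also have "\<dots> = p_act (f ^ n) (y_pow n (p_act (r n) v))"
    using v low[of n] by (simp add: y_comb_smult_Suc smult_r_distr)
  also have "\<dots> = p_act (of_nat (fact n) * (- (h * pderiv f)) ^ n * r n) v"
    using v u by (simp add: power_p_act_y_pow p_act_mult)
  finally have "f dvd of_nat (fact n) * (- (h * pderiv f)) ^ n * r n"
    using p_act_eq_zero_iff[OF max v] by metis
  \<comment> \<open>In characteristic 0 the integer n! is a nonzero constant, hence a unit of R, and
    f does not divide 1.\<close>
  moreover have "\<not> f dvd of_nat (fact n)"
  proof
    assume *: "f dvd of_nat (fact n)"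
    have "(of_nat (fact n) :: 'f) \<noteq> 0"
      using char by (simp add: of_nat_eq_0_iff_char_dvd)
    then have "of_nat (fact n) dvd (1 :: 'f poly)"
      by (simp add: of_nat_poly is_unit_const_poly_iff dvd_field_iff)
    with * have "f dvd 1"
      by (rule dvd_trans)
    then show False
      using f by (meson dvd_trans one_dvd)
  qed
  moreover have "\<not> f dvd (- (h * pderiv f)) ^ n"
  proof (induction n)
    case 0
    show ?case using f by (simp add: dvd_unit_imp_unit) (meson dvd_trans one_dvd)
  next
    case (Suc n)
    then show ?case
      using maximalideal_polyR_prime[OF max] f by (metis dvd_minus_iff power_Suc)
  qed
  ultimately have rn: "f dvd r n"
    using maximalideal_polyR_prime[OF max] by blast
  show ?case
  proof (cases "j = n")
    case False
    have "p_act (r n) v = \<zero>\<^bsub>M\<^esub>"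
      using rn p_act_eq_zero_iff[OF max v] by simp
    then have "y_comb h n r \<odot>\<^bsub>M\<^esub> v = \<zero>\<^bsub>M\<^esub>"
      using Suc.prems v by (simp add: y_comb_smult_Suc)
    with False Suc show ?thesis by simp
  qed (use rn in simp)
qed simp

end

section \<open>Induced modules of cyclic modules\<close>

text \<open>The isomorphism sends \<open>\<sigma> a\<close> to \<open>\<tau> a\<close>; equal
  kernels make it well defined and injective. W enters only as an abelian group because its scalar
  action is read off through \<open>\<tau>\<close>, which spares checking the module axioms on
  quotients.\<close>

lemma module_iso_if_same_kernel:
  assumes A: "ring A" and V: "left_module A V" and W: "abelian_group W"
    and \<sigma>: "\<And>a b. a \<in> carrier A \<Longrightarrow> b \<in> carrier A \<Longrightarrow> \<sigma> (a \<oplus>\<^bsub>A\<^esub> b) = \<sigma> a \<oplus>\<^bsub>V\<^esub> \<sigma> b"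
      "\<And>a b. a \<in> carrier A \<Longrightarrow> b \<in> carrier A \<Longrightarrow> \<sigma> (a \<otimes>\<^bsub>A\<^esub> b) = a \<odot>\<^bsub>V\<^esub> \<sigma> b"
      "carrier V = \<sigma> ` carrier A"
    and \<tau>: "\<And>a b. a \<in> carrier A \<Longrightarrow> b \<in> carrier A \<Longrightarrow> \<tau> (a \<oplus>\<^bsub>A\<^esub> b) = \<tau> a \<oplus>\<^bsub>W\<^esub> \<tau> b"
      "\<And>a b. a \<in> carrier A \<Longrightarrow> b \<in> carrier A \<Longrightarrow> \<tau> (a \<otimes>\<^bsub>A\<^esub> b) = a \<odot>\<^bsub>W\<^esub> \<tau> b"
      "carrier W = \<tau> ` carrier A"
    and ker: "\<And>a. a \<in> carrier A \<Longrightarrow> \<sigma> a = \<zero>\<^bsub>V\<^esub> \<longleftrightarrow> \<tau> a = \<zero>\<^bsub>W\<^esub>"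
  shows "module_iso A V W"
proof -
  interpret A: ring A by fact
  interpret V: left_module A V by fact
  interpret W: abelian_group W by fact
  \<comment> \<open>Stated for an arbitrary target because V and W have different types. It turns
    equality of kernels into equality of fibres.\<close>
  have diff: "\<rho> (a_minus A a b) = \<zero>\<^bsub>Q\<^esub> \<longleftrightarrow> \<rho> a = \<rho> b"
    if "abelian_group Q" "\<And>a b. a \<in> carrier A \<Longrightarrow> b \<in> carrier A \<Longrightarrow> \<rho> (a \<oplus>\<^bsub>A\<^esub> b) = \<rho> a \<oplus>\<^bsub>Q\<^esub> \<rho> b"
      "carrier Q = \<rho> ` carrier A" "a \<in> carrier A" "b \<in> carrier A"
    for Q :: "('a, 'z, 'y) module_scheme" and \<rho> a b
  proof -
    interpret Q: abelian_group Q by fact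
    have cl: "\<rho> (a_minus A a b) \<in> carrier Q" "\<rho> b \<in> carrier Q"
      using that(3-5) by auto
    have "\<rho> a = \<rho> (a_minus A a b) \<oplus>\<^bsub>Q\<^esub> \<rho> b"
      using that(2)[of "a_minus A a b" b] that(4,5) by (simp add: a_minus_def A.a_assoc A.l_neg)
    then show ?thesis
      using cl by simp
  qed
  have eq: "\<sigma> a = \<sigma> b \<longleftrightarrow> \<tau> a = \<tau> b" if "a \<in> carrier A" "b \<in> carrier A" for a b
    using diff[of V \<sigma> a b] diff[of W \<tau> a b] ker[of "a_minus A a b"] that \<sigma>(1,3) \<tau>(1,3)
      V.M.abelian_group_axioms W.abelian_group_axioms by simp
  define \<phi> where "\<phi> v = \<tau> (SOME a. a \<in> carrier A \<and> \<sigma> a = v)" for v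
  have \<phi>: "\<phi> (\<sigma> a) = \<tau> a" if "a \<in> carrier A" for a
    using someI[of "\<lambda>b. b \<in> carrier A \<and> \<sigma> b = \<sigma> a" a] eq that unfolding \<phi>_def by blast
  have "bij_betw \<phi> (carrier V) (carrier W)"
    unfolding bij_betw_def inj_on_def \<sigma>(3) \<tau>(3) using \<phi> eq by (auto simp: image_iff)
  moreover have "\<phi> (v \<oplus>\<^bsub>V\<^esub> w) = \<phi> v \<oplus>\<^bsub>W\<^esub> \<phi> w" if vw: "v \<in> carrier V" "w \<in> carrier V" for v w
  proof -
    obtain a b where "a \<in> carrier A" "b \<in> carrier A" "v = \<sigma> a" "w = \<sigma> b"
      using vw \<sigma>(3) by blast
    then show ?thesis
      using \<phi>[of "a \<oplus>\<^bsub>A\<^esub> b"] by (simp add: \<sigma>(1) \<tau>(1) \<phi>)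
  qed
  moreover have "\<phi> (a \<odot>\<^bsub>V\<^esub> v) = a \<odot>\<^bsub>W\<^esub> \<phi> v" if "a \<in> carrier A" and v: "v \<in> carrier V" for a v
  proof -
    obtain b where "b \<in> carrier A" "v = \<sigma> b"
      using v \<sigma>(3) by blast
    then show ?thesis
      using \<phi>[of "a \<otimes>\<^bsub>A\<^esub> b"] that(1) by (simp add: \<sigma>(2) \<tau>(2) \<phi>)
  qed
  ultimately show ?thesis
    unfolding module_iso_def by blast
qed

text \<open>A v is a submodule containing v = 1 v, so it is not zero.\<close>

lemma irreducible_module_cyclic:
  assumes "irreducible_module A V" "v \<in> carrier V" "v \<noteq> \<zero>\<^bsub>V\<^esub>"
  shows "carrier V = (\<lambda>a. a \<odot>\<^bsub>V\<^esub> v) ` carrier A"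
proof -
  interpret left_module A V
    using assms(1) by (simp add: irreducible_module_def)
  let ?N = "(\<lambda>a. a \<odot>\<^bsub>V\<^esub> v) ` carrier A"
  have mem: "a \<odot>\<^bsub>V\<^esub> v \<in> ?N" if "a \<in> carrier A" for a
    using that by blast
  have zero: "\<zero>\<^bsub>A\<^esub> \<odot>\<^bsub>V\<^esub> v = \<zero>\<^bsub>V\<^esub>"
    using smult_l_distr[of "\<zero>\<^bsub>A\<^esub>" "\<zero>\<^bsub>A\<^esub>" v] assms(2) smult_closed[of "\<zero>\<^bsub>A\<^esub>" v]
      M.add.r_cancel_one[of "\<zero>\<^bsub>A\<^esub> \<odot>\<^bsub>V\<^esub> v" "\<zero>\<^bsub>A\<^esub> \<odot>\<^bsub>V\<^esub> v"] by simp
  have minus: "\<ominus>\<^bsub>V\<^esub> (a \<odot>\<^bsub>V\<^esub> v) = (\<ominus>\<^bsub>A\<^esub> a) \<odot>\<^bsub>V\<^esub> v" if "a \<in> carrier A" for a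
    using that smult_l_distr[of "\<ominus>\<^bsub>A\<^esub> a" a v] assms(2) zero smult_closed
    by (intro M.minus_equality) (simp_all add: R.l_neg)
  have "submodule ?N A V"
    unfolding submodule_def submodule_axioms_def
  proof (intro conjI allI impI M.add.subgroupI)
    show "?N \<subseteq> carrier V"
      using assms(2) smult_closed by auto
    show "?N \<noteq> {}" by blast
    show "\<ominus>\<^bsub>V\<^esub> w \<in> ?N" if "w \<in> ?N" for w
      using that mem minus by auto
    show "u \<oplus>\<^bsub>V\<^esub> w \<in> ?N" if "u \<in> ?N" "w \<in> ?N" for u w
      using that mem assms(2) by (auto simp flip: smult_l_distr)
    show "a \<odot>\<^bsub>V\<^esub> w \<in> ?N" if "a \<in> carrier A" "w \<in> ?N" for a w
      using that mem assms(2) by (auto simp flip: smult_assoc)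
  qed
  moreover have "v \<in> ?N"
    using mem[of "\<one>\<^bsub>A\<^esub>"] smult_one assms(2) by simp
  ultimately show ?thesis
    using assms(1,3) unfolding irreducible_module_def by blast
qed

lemma regular_module_carrier [simp]: "carrier (regular_module R) = carrier R"
  and regular_module_a_rcosets [simp]: "a_rcosets\<^bsub>regular_module R\<^esub> m = a_rcosets\<^bsub>R\<^esub> m"
  and regular_module_a_r_coset [simp]: "m +>\<^bsub>regular_module R\<^esub> r = m +>\<^bsub>R\<^esub> r"
  and regular_module_set_add [simp]: "set_add (regular_module R) = set_add R"
  and regular_module_smult [simp]: "module.smult (regular_module R) = monoid.mult R"
  by (simp_all add: regular_module_def A_RCOSETS_def RCOSETS_def a_r_coset_def r_coset_def
      set_add_def set_mult_def fun_eq_iff)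

text \<open>The group predicates inspect only carrier, product and unit. The extension part has to
  be changed because \<open>add_monoid\<close> puts an unspecified one there, while a quotient group
  has none.\<close>

lemma comm_group_truncate:
  "comm_group \<lparr>carrier = C, monoid.mult = f, one = e\<rparr> \<Longrightarrow>
    comm_group \<lparr>carrier = C, monoid.mult = f, one = e, \<dots> = z\<rparr>"
  unfolding comm_group_def comm_monoid_def comm_monoid_axioms_def monoid_def group_def
    group_axioms_def Units_def partial_object.simps monoid.simps .

lemma quot_module_simps:
  "carrier (quot_module M N) = a_rcosets\<^bsub>M\<^esub> N"
  "\<zero>\<^bsub>quot_module M N\<^esub> = N"
  "C \<oplus>\<^bsub>quot_module M N\<^esub> D = C <+>\<^bsub>M\<^esub> D"
  "a \<odot>\<^bsub>quot_module M N\<^esub> C = (\<Union>v\<in>C. N +>\<^bsub>M\<^esub> (a \<odot>\<^bsub>M\<^esub> v))"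
  by (simp_all add: quot_module_def)

text \<open>The tensor calculus for A \<otimes>_R R/m along a ring homomorphism R \<rightarrow> A;
  later R = F[x] and A = A_h.\<close>

locale cyclic_induction =
  hom: ring_hom_ring R A \<phi> + ideal m R
  for R :: "('r, 'e) ring_scheme" (structure) and A :: "('a, 'c) ring_scheme" (structure)
    and \<phi> and m
begin

definition N :: "('r, 'r set) module"
  where "N = quot_module (regular_module R) m"

definition F :: "('a \<times> 'r set \<Rightarrow>\<^sub>0 int) monoid"
  where "F = free_Abelian_group (carrier A \<times> carrier N)"

definition K :: "('a \<times> 'r set \<Rightarrow>\<^sub>0 int) set"
  where "K = generate F (tensor_rels A R \<phi> N)"

definition U :: "('a, ('a \<times> 'r set \<Rightarrow>\<^sub>0 int) set) module"
  where "U = induced_module A R \<phi> N"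

text \<open>The map a \<mapsto> a \<otimes> 1, that is, a applied to the canonical generator of the
  induced module.\<close>

definition \<theta> :: "'a \<Rightarrow> ('a \<times> 'r set \<Rightarrow>\<^sub>0 int) set"
  where "\<theta> a = K #>\<^bsub>F\<^esub> frag_of (a, m +>\<^bsub>R\<^esub> \<one>\<^bsub>R\<^esub>)"

definition tensor_act :: "'a \<Rightarrow> ('a \<times> 'r set \<Rightarrow>\<^sub>0 int) \<Rightarrow> ('a \<times> 'r set \<Rightarrow>\<^sub>0 int)"
  where "tensor_act a = frag_extend (\<lambda>(b, n). frag_of (a \<otimes>\<^bsub>A\<^esub> b, n))"

lemma U_simps:
  "carrier U = rcosets\<^bsub>F\<^esub> K" "\<zero>\<^bsub>U\<^esub> = K" "C \<oplus>\<^bsub>U\<^esub> D = C <#>\<^bsub>F\<^esub> D"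
  "a \<odot>\<^bsub>U\<^esub> C = (\<Union>c\<in>C. K #>\<^bsub>F\<^esub> tensor_act a c)"
  by (simp_all add: U_def induced_module_def Let_def FactGroup_def K_def F_def tensor_act_def)

lemma N_carrier: "n \<in> carrier N \<longleftrightarrow> (\<exists>r\<in>carrier R. n = m +>\<^bsub>R\<^esub> r)"
  by (auto simp: N_def quot_module_simps A_RCOSETS_def')

lemma N_add: "r \<in> carrier R \<Longrightarrow> s \<in> carrier R \<Longrightarrow>
    (m +>\<^bsub>R\<^esub> r) \<oplus>\<^bsub>N\<^esub> (m +>\<^bsub>R\<^esub> s) = m +>\<^bsub>R\<^esub> (r \<oplus>\<^bsub>R\<^esub> s)"
  by (simp add: N_def quot_module_simps a_rcos_sum)

text \<open>The scalar action on cosets is defined as a union over all members t of the coset; the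
  cosets of the products r t coincide because m absorbs left multiplication.\<close>

lemma N_smult: "r \<in> carrier R \<Longrightarrow> s \<in> carrier R \<Longrightarrow>
    r \<odot>\<^bsub>N\<^esub> (m +>\<^bsub>R\<^esub> s) = m +>\<^bsub>R\<^esub> (r \<otimes>\<^bsub>R\<^esub> s)"
proof -
  assume rs: "r \<in> carrier R" "s \<in> carrier R"
  have "m +>\<^bsub>R\<^esub> (r \<otimes>\<^bsub>R\<^esub> t) = m +>\<^bsub>R\<^esub> (r \<otimes>\<^bsub>R\<^esub> s)" if t: "t \<in> m +>\<^bsub>R\<^esub> s" for t
  proof -
    obtain x where x: "x \<in> m" "t = x \<oplus>\<^bsub>R\<^esub> s"
      using t by (auto simp: a_r_coset_def')
    then have "r \<otimes>\<^bsub>R\<^esub> t = r \<otimes>\<^bsub>R\<^esub> x \<oplus>\<^bsub>R\<^esub> r \<otimes>\<^bsub>R\<^esub> s" "r \<otimes>\<^bsub>R\<^esub> x \<in> m"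
      using rs I_l_closed Icarr by (simp_all add: hom.R.r_distr)
    then have "r \<otimes>\<^bsub>R\<^esub> t \<in> m +>\<^bsub>R\<^esub> (r \<otimes>\<^bsub>R\<^esub> s)"
      unfolding a_r_coset_def' by auto
    then show ?thesis
      by (rule hom.R.a_repr_independence[symmetric]) (use rs in \<open>auto intro: a_subgroup\<close>)
  qed
  moreover have "s \<in> m +>\<^bsub>R\<^esub> s"
    by (rule a_rcos_self[OF rs(2)])
  ultimately have "(\<Union>t\<in>m +>\<^bsub>R\<^esub> s. m +>\<^bsub>R\<^esub> (r \<otimes>\<^bsub>R\<^esub> t)) = m +>\<^bsub>R\<^esub> (r \<otimes>\<^bsub>R\<^esub> s)"
    by blast
  then show ?thesis
    by (simp add: N_def quot_module_simps)
qed

section \<open>The free abelian group and the subgroup of tensor relations\<close>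

lemma mem_F: "x \<in> carrier F \<longleftrightarrow> Poly_Mapping.keys x \<subseteq> carrier A \<times> carrier N"
  by (simp add: F_def)

lemma F_simps [simp]: "x \<otimes>\<^bsub>F\<^esub> y = x + y" "\<one>\<^bsub>F\<^esub> = 0"
  by (simp_all add: F_def)

lemma frag_of_mem_F: "frag_of (a, n) \<in> carrier F \<longleftrightarrow> a \<in> carrier A \<and> n \<in> carrier N"
  by (auto simp: mem_F)

lemma F_closed: "x \<in> carrier F \<Longrightarrow> y \<in> carrier F \<Longrightarrow> x + y \<in> carrier F"
  "x \<in> carrier F \<Longrightarrow> y \<in> carrier F \<Longrightarrow> x - y \<in> carrier F"
  unfolding mem_F using keys_add[of x y] keys_diff[of x y] by blast+

lemma F_inv: "x \<in> carrier F \<Longrightarrow> inv\<^bsub>F\<^esub> x = - x"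
  by (simp add: mem_F F_def)

lemma comm_group_F: "comm_group F"
  unfolding F_def by (rule abelian_free_Abelian_group)

lemma N_closed:
  "n \<in> carrier N \<Longrightarrow> n' \<in> carrier N \<Longrightarrow> n \<oplus>\<^bsub>N\<^esub> n' \<in> carrier N"
  "r \<in> carrier R \<Longrightarrow> n \<in> carrier N \<Longrightarrow> r \<odot>\<^bsub>N\<^esub> n \<in> carrier N"
proof -
  have *: "m +>\<^bsub>R\<^esub> r \<in> carrier N" if "r \<in> carrier R" for r
    using that N_carrier by blast
  show "n \<in> carrier N \<Longrightarrow> n' \<in> carrier N \<Longrightarrow> n \<oplus>\<^bsub>N\<^esub> n' \<in> carrier N"
    by (auto simp: N_carrier[of n] N_carrier[of n'] N_add intro!: * hom.R.a_closed)
  show "r \<in> carrier R \<Longrightarrow> n \<in> carrier N \<Longrightarrow> r \<odot>\<^bsub>N\<^esub> n \<in> carrier N"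
    by (auto simp: N_carrier[of n] N_smult intro!: * hom.R.m_closed)
qed

lemma tensor_rels_closed: "tensor_rels A R \<phi> N \<subseteq> carrier F"
  unfolding tensor_rels_def using N_closed by (auto intro!: F_closed simp: frag_of_mem_F)

lemma subgroup_K: "subgroup K F"
  unfolding K_def
  by (rule group.generate_is_subgroup[OF _ tensor_rels_closed])
    (use comm_group_F comm_group_def in blast)

lemma normal_K: "K \<lhd> F"
  using comm_group.subgroup_imp_normal[OF comm_group_F subgroup_K] .

sublocale K: normal K F
  by (rule normal_K)

lemma tensor_rels_intros:
  "b \<in> carrier A \<Longrightarrow> b' \<in> carrier A \<Longrightarrow> n \<in> carrier N \<Longrightarrow>
    frag_of (b \<oplus>\<^bsub>A\<^esub> b', n) - frag_of (b, n) - frag_of (b', n) \<in> tensor_rels A R \<phi> N"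
  "b \<in> carrier A \<Longrightarrow> n \<in> carrier N \<Longrightarrow> n' \<in> carrier N \<Longrightarrow>
    frag_of (b, n \<oplus>\<^bsub>N\<^esub> n') - frag_of (b, n) - frag_of (b, n') \<in> tensor_rels A R \<phi> N"
  "b \<in> carrier A \<Longrightarrow> r \<in> carrier R \<Longrightarrow> n \<in> carrier N \<Longrightarrow>
    frag_of (b \<otimes>\<^bsub>A\<^esub> \<phi> r, n) - frag_of (b, r \<odot>\<^bsub>N\<^esub> n) \<in> tensor_rels A R \<phi> N"
  unfolding tensor_rels_def by blast+

lemma tensor_rels_cases [consumes 1, case_names add_left add_right balanced]:
  assumes "x \<in> tensor_rels A R \<phi> N"
  obtains b b' n where "b \<in> carrier A" "b' \<in> carrier A" "n \<in> carrier N"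
      "x = frag_of (b \<oplus>\<^bsub>A\<^esub> b', n) - frag_of (b, n) - frag_of (b', n)"
    | b n n' where "b \<in> carrier A" "n \<in> carrier N" "n' \<in> carrier N"
      "x = frag_of (b, n \<oplus>\<^bsub>N\<^esub> n') - frag_of (b, n) - frag_of (b, n')"
    | b r n where "b \<in> carrier A" "r \<in> carrier R" "n \<in> carrier N"
      "x = frag_of (b \<otimes>\<^bsub>A\<^esub> \<phi> r, n) - frag_of (b, r \<odot>\<^bsub>N\<^esub> n)"
  using assms unfolding tensor_rels_def
  by (elim UnE CollectE exE conjE) (rule that(1) that(2) that(3); assumption)+

lemma rel_mem_K: "x \<in> tensor_rels A R \<phi> N \<Longrightarrow> x \<in> K"
  unfolding K_def by (rule generate.incl)

lemma coset_eq:
  assumes "x \<in> carrier F" "y \<in> carrier F" "x - y \<in> K"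
  shows "K #>\<^bsub>F\<^esub> x = K #>\<^bsub>F\<^esub> y"
proof -
  have "x \<in> K #>\<^bsub>F\<^esub> y"
    unfolding r_coset_def using assms(3) by (auto intro!: bexI[of _ "x - y"])
  then show ?thesis
    using K.repr_independence[OF _ assms(2) subgroup_K] by simp
qed

lemma coset_sum:
  "x \<in> carrier F \<Longrightarrow> y \<in> carrier F \<Longrightarrow> (K #>\<^bsub>F\<^esub> x) \<oplus>\<^bsub>U\<^esub> (K #>\<^bsub>F\<^esub> y) = K #>\<^bsub>F\<^esub> (x + y)"
  using K.rcos_sum[of x y] by (simp add: U_simps)

section \<open>The induced module and its generator\<close>

lemma abelian_group_U: "abelian_group U"
proof (rule comm_group_abelian_groupI)
  show "comm_group (add_monoid U)"
    using comm_group.abelian_FactGroup[OF comm_group_F subgroup_K]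
    by (simp add: U_def induced_module_def Let_def FactGroup_def K_def F_def comm_group_truncate)
qed

sublocale U: abelian_group U
  by (rule abelian_group_U)

lemma one_coset [simp]: "m +>\<^bsub>R\<^esub> \<one>\<^bsub>R\<^esub> \<in> carrier N"
  by (auto simp: N_carrier)

lemma \<theta>_closed [simp]: "a \<in> carrier A \<Longrightarrow> \<theta> a \<in> carrier U"
  unfolding \<theta>_def U_simps by (auto simp: RCOSETS_def frag_of_mem_F)

lemma \<theta>_add:
  assumes "a \<in> carrier A" "b \<in> carrier A"
  shows "\<theta> (a \<oplus>\<^bsub>A\<^esub> b) = \<theta> a \<oplus>\<^bsub>U\<^esub> \<theta> b"
proof -
  let ?n = "m +>\<^bsub>R\<^esub> \<one>\<^bsub>R\<^esub>"
  have "frag_of (a \<oplus>\<^bsub>A\<^esub> b, ?n) - frag_of (a, ?n) - frag_of (b, ?n) \<in> K"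
    by (intro rel_mem_K tensor_rels_intros) (use assms in auto)
  moreover have mem: "frag_of (c, ?n) \<in> carrier F" if "c \<in> carrier A" for c
    using that by (simp add: frag_of_mem_F)
  ultimately show ?thesis
    unfolding \<theta>_def coset_sum[OF mem[OF assms(1)] mem[OF assms(2)]]
    by (intro coset_eq F_closed mem) (use assms in \<open>simp_all add: diff_diff_eq\<close>)
qed

lemma \<theta>_zero: "\<theta> \<zero>\<^bsub>A\<^esub> = \<zero>\<^bsub>U\<^esub>"
  using \<theta>_add[of "\<zero>\<^bsub>A\<^esub>" "\<zero>\<^bsub>A\<^esub>"] U.add.r_cancel_one[of "\<theta> \<zero>\<^bsub>A\<^esub>" "\<theta> \<zero>\<^bsub>A\<^esub>"] by simp

text \<open>The balanced relation at the generator, a \<otimes> r 1 = a r \<otimes> 1. Hence every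
  pure tensor lies in the image of \<open>\<theta>\<close>.\<close>

lemma pure_tensor_eq_\<theta>:
  assumes "a \<in> carrier A" "r \<in> carrier R"
  shows "K #>\<^bsub>F\<^esub> frag_of (a, m +>\<^bsub>R\<^esub> r) = \<theta> (a \<otimes>\<^bsub>A\<^esub> \<phi> r)"
proof -
  have "frag_of (a \<otimes>\<^bsub>A\<^esub> \<phi> r, m +>\<^bsub>R\<^esub> \<one>\<^bsub>R\<^esub>) - frag_of (a, r \<odot>\<^bsub>N\<^esub> (m +>\<^bsub>R\<^esub> \<one>\<^bsub>R\<^esub>)) \<in> K"
    by (intro rel_mem_K tensor_rels_intros) (use assms in auto)
  then show ?thesis
    unfolding \<theta>_def using assms
    by (intro coset_eq[symmetric]) (auto simp: N_smult frag_of_mem_F N_carrier)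
qed

text \<open>Moving p across the tensor sign turns it into the zero coset.\<close>

lemma \<theta>_annihilates:
  assumes "a \<in> carrier A" "p \<in> m"
  shows "\<theta> (a \<otimes>\<^bsub>A\<^esub> \<phi> p) = \<zero>\<^bsub>U\<^esub>"
proof -
  have "m +>\<^bsub>R\<^esub> p = m +>\<^bsub>R\<^esub> \<zero>\<^bsub>R\<^esub>"
    using assms(2) a_rcos_const a_subset hom.R.a_coset_add_zero by simp
  then have "\<theta> (a \<otimes>\<^bsub>A\<^esub> \<phi> p) = \<theta> (a \<otimes>\<^bsub>A\<^esub> \<phi> \<zero>\<^bsub>R\<^esub>)"
    using pure_tensor_eq_\<theta>[of a p] pure_tensor_eq_\<theta>[of a "\<zero>\<^bsub>R\<^esub>"] assms Icarr by simp
  then show ?thesis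
    using assms \<theta>_zero by simp
qed

text \<open>Pure tensors lie in the image of \<open>\<theta>\<close>, and that image is closed under
  differences, the operation by which the induction builds up the free abelian group.\<close>

lemma carrier_U: "carrier U = \<theta> ` carrier A"
proof
  have "K #>\<^bsub>F\<^esub> x \<in> \<theta> ` carrier A" if "x \<in> carrier F" for x
    using that unfolding mem_F
  proof (induction x rule: free_Abelian_group_induct[consumes 1])
    case 1
    have "K #>\<^bsub>F\<^esub> 0 = \<zero>\<^bsub>U\<^esub>"
      using K.coset_mult_one[OF K.subset] by (simp add: U_simps)
    then show ?case
      using \<theta>_zero by (intro image_eqI[of _ _ "\<zero>\<^bsub>A\<^esub>"]) simp_all
  next
    case (2 x y)
    then obtain a b where ab: "a \<in> carrier A" "b \<in> carrier A" "K #>\<^bsub>F\<^esub> x = \<theta> a" "K #>\<^bsub>F\<^esub> y = \<theta> b"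
      by blast
    have xy: "x \<in> carrier F" "y \<in> carrier F" "x - y \<in> carrier F"
      using 2(1,2) F_closed(2)[of x y] by (simp_all add: mem_F)
    then have cl: "K #>\<^bsub>F\<^esub> (x - y) \<in> carrier U"
      by (auto simp: U_simps RCOSETS_def)
    have "(K #>\<^bsub>F\<^esub> (x - y)) \<oplus>\<^bsub>U\<^esub> \<theta> b = \<theta> a"
      using coset_sum[OF xy(3,2)] ab by simp
    moreover have "\<theta> (a \<ominus>\<^bsub>A\<^esub> b) \<oplus>\<^bsub>U\<^esub> \<theta> b = \<theta> a"
      using ab by (simp flip: \<theta>_add add: a_minus_def hom.S.a_assoc hom.S.l_neg)
    ultimately have "K #>\<^bsub>F\<^esub> (x - y) = \<theta> (a \<ominus>\<^bsub>A\<^esub> b)"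
      using ab cl U.add.right_cancel[of "\<theta> b" "K #>\<^bsub>F\<^esub> (x - y)" "\<theta> (a \<ominus>\<^bsub>A\<^esub> b)"] by simp
    then show ?case
      using ab by blast
  next
    case (3 z)
    then show ?case
      by (auto simp: N_carrier pure_tensor_eq_\<theta>)
  qed
  then show "carrier U \<subseteq> \<theta> ` carrier A"
    by (auto simp: U_simps RCOSETS_def)
qed auto

lemma tensor_act_closed:
  assumes "a \<in> carrier A" "x \<in> carrier F"
  shows "tensor_act a x \<in> carrier F"
  using assms(2) unfolding mem_F
proof (induction x rule: free_Abelian_group_induct[consumes 1])
  case (2 x y)
  then show ?case
    unfolding tensor_act_def frag_extend_diff using F_closed(2) by (simp add: mem_F)
qed (use assms(1) in \<open>auto simp: tensor_act_def\<close>)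

text \<open>Left multiplication by a is additive and commutes with right multiplication by
  \<open>\<phi> r\<close>, so it keeps the type of each relation. Stability of K then follows
  generator by generator.\<close>

lemma tensor_act_rels:
  assumes a: "a \<in> carrier A" and "x \<in> tensor_rels A R \<phi> N"
  shows "tensor_act a x \<in> tensor_rels A R \<phi> N"
  using assms(2)
proof (cases rule: tensor_rels_cases)
  case (add_left b b' n)
  have "tensor_act a x = frag_of (a \<otimes>\<^bsub>A\<^esub> b \<oplus>\<^bsub>A\<^esub> a \<otimes>\<^bsub>A\<^esub> b', n) -
      frag_of (a \<otimes>\<^bsub>A\<^esub> b, n) - frag_of (a \<otimes>\<^bsub>A\<^esub> b', n)"
    using add_left a by (simp add: tensor_act_def frag_extend_diff hom.S.r_distr)
  moreover have "a \<otimes>\<^bsub>A\<^esub> b \<in> carrier A" "a \<otimes>\<^bsub>A\<^esub> b' \<in> carrier A"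
    using add_left a by auto
  ultimately show ?thesis
    using add_left(3) by (simp add: tensor_rels_intros)
next
  case (add_right b n n')
  have "tensor_act a x = frag_of (a \<otimes>\<^bsub>A\<^esub> b, n \<oplus>\<^bsub>N\<^esub> n') -
      frag_of (a \<otimes>\<^bsub>A\<^esub> b, n) - frag_of (a \<otimes>\<^bsub>A\<^esub> b, n')"
    using add_right by (simp add: tensor_act_def frag_extend_diff)
  moreover have "a \<otimes>\<^bsub>A\<^esub> b \<in> carrier A"
    using add_right a by auto
  ultimately show ?thesis
    using add_right(2,3) by (simp add: tensor_rels_intros)
next
  case (balanced b r n)
  have "tensor_act a x = frag_of ((a \<otimes>\<^bsub>A\<^esub> b) \<otimes>\<^bsub>A\<^esub> \<phi> r, n) -
      frag_of (a \<otimes>\<^bsub>A\<^esub> b, r \<odot>\<^bsub>N\<^esub> n)"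
    using balanced a by (simp add: tensor_act_def frag_extend_diff hom.S.m_assoc)
  moreover have "a \<otimes>\<^bsub>A\<^esub> b \<in> carrier A"
    using balanced a by auto
  ultimately show ?thesis
    using balanced(2,3) by (simp add: tensor_rels_intros)
qed

lemma tensor_act_K:
  assumes a: "a \<in> carrier A" and "x \<in> K"
  shows "tensor_act a x \<in> K"
  using assms(2) unfolding K_def
proof (induction x rule: generate.induct)
  case one
  show ?case by (simp add: tensor_act_def generate.one[of F, simplified])
next
  case (incl x)
  then show ?case by (intro generate.incl tensor_act_rels a)
next
  case (inv x)
  then have x: "x \<in> carrier F" using tensor_rels_closed by blast
  show ?case
    using generate.inv[OF tensor_act_rels[OF a inv], of F] x tensor_act_closed[OF a x]
    by (simp add: F_inv tensor_act_def frag_extend_minus)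
next
  case (eng x y)
  then show ?case
    using generate.eng[OF eng.IH] by (simp add: tensor_act_def frag_extend_add)
qed

text \<open>The action is defined as a union over a coset. Since \<open>tensor_act a\<close>
  preserves K, every member yields the same coset, and the representative b \<otimes> 1 computes
  it.\<close>

lemma smult_\<theta>:
  assumes "a \<in> carrier A" "b \<in> carrier A"
  shows "a \<odot>\<^bsub>U\<^esub> \<theta> b = \<theta> (a \<otimes>\<^bsub>A\<^esub> b)"
proof -
  let ?x = "frag_of (b, m +>\<^bsub>R\<^esub> \<one>\<^bsub>R\<^esub>)"
  have x: "?x \<in> carrier F" "tensor_act a ?x = frag_of (a \<otimes>\<^bsub>A\<^esub> b, m +>\<^bsub>R\<^esub> \<one>\<^bsub>R\<^esub>)"
    using assms by (auto simp: frag_of_mem_F tensor_act_def)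
  have "K #>\<^bsub>F\<^esub> tensor_act a c = \<theta> (a \<otimes>\<^bsub>A\<^esub> b)" if "c \<in> \<theta> b" for c
  proof -
    obtain k where k: "k \<in> K" "c = k + ?x"
      using \<open>c \<in> \<theta> b\<close> by (auto simp: \<theta>_def r_coset_def)
    then have "tensor_act a c - tensor_act a ?x = tensor_act a k"
      by (simp add: tensor_act_def frag_extend_add)
    moreover have "c \<in> carrier F"
      using k x K.subset by (auto intro: F_closed)
    ultimately show ?thesis
      unfolding \<theta>_def x(2)[symmetric] using assms(1) k x(1)
      by (intro coset_eq tensor_act_closed) (auto simp: tensor_act_K)
  qed
  moreover have "?x \<in> \<theta> b"
    unfolding \<theta>_def by (rule K.rcos_self[OF x(1) subgroup_K])
  ultimately show ?thesis
    unfolding U_simps by blast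
qed

lemma left_module_U: "left_module A U"
proof -
  have "left_module_axioms A U"
  proof
    show "a \<odot>\<^bsub>U\<^esub> u \<in> carrier U" if "a \<in> carrier A" "u \<in> carrier U" for a u
      using that unfolding carrier_U by (auto simp: smult_\<theta>)
    show "\<one>\<^bsub>A\<^esub> \<odot>\<^bsub>U\<^esub> u = u" if "u \<in> carrier U" for u
      using that unfolding carrier_U by (auto simp: smult_\<theta>)
    show "(a \<oplus>\<^bsub>A\<^esub> b) \<odot>\<^bsub>U\<^esub> u = a \<odot>\<^bsub>U\<^esub> u \<oplus>\<^bsub>U\<^esub> b \<odot>\<^bsub>U\<^esub> u"
      if "a \<in> carrier A" "b \<in> carrier A" "u \<in> carrier U" for a b u
      using that unfolding carrier_U by (auto simp: smult_\<theta> hom.S.l_distr \<theta>_add)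
    show "a \<odot>\<^bsub>U\<^esub> (u \<oplus>\<^bsub>U\<^esub> w) = a \<odot>\<^bsub>U\<^esub> u \<oplus>\<^bsub>U\<^esub> a \<odot>\<^bsub>U\<^esub> w"
      if "a \<in> carrier A" "u \<in> carrier U" "w \<in> carrier U" for a u w
      using that unfolding carrier_U
      by (auto simp: smult_\<theta> hom.S.r_distr simp flip: \<theta>_add)
    show "(a \<otimes>\<^bsub>A\<^esub> b) \<odot>\<^bsub>U\<^esub> u = a \<odot>\<^bsub>U\<^esub> (b \<odot>\<^bsub>U\<^esub> u)"
      if "a \<in> carrier A" "b \<in> carrier A" "u \<in> carrier U" for a b u
      using that unfolding carrier_U by (auto simp: smult_\<theta> hom.S.m_assoc)
  qed
  then show ?thesis
    by (simp add: left_module_def hom.S.ring_axioms abelian_group_U)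
qed

text \<open>The map (b, r + m) \<mapsto> b r v is biadditive and balanced, so it factors through the
  tensor product and sends a \<otimes> 1 to a v. Relations in U therefore persist at every vector
  killed by m.\<close>

lemma \<theta>_eq_zero_imp:
  assumes M: "left_module A M" and v: "v \<in> carrier M" "\<And>p. p \<in> m \<Longrightarrow> \<phi> p \<odot>\<^bsub>M\<^esub> v = \<zero>\<^bsub>M\<^esub>"
    and a: "a \<in> carrier A" "\<theta> a = \<zero>\<^bsub>U\<^esub>"
  shows "a \<odot>\<^bsub>M\<^esub> v = \<zero>\<^bsub>M\<^esub>"
proof -
  interpret M: left_module A M by fact
  \<comment> \<open>The R-linear map R/m \<rightarrow> M sending 1 to v. The choice of
    representative is harmless because m kills v.\<close>
  define g where "g n = \<phi> (SOME r. r \<in> n) \<odot>\<^bsub>M\<^esub> v" for n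
  have g: "g (m +>\<^bsub>R\<^esub> r) = \<phi> r \<odot>\<^bsub>M\<^esub> v" if r: "r \<in> carrier R" for r
  proof -
    have "(SOME s. s \<in> m +>\<^bsub>R\<^esub> r) \<in> m +>\<^bsub>R\<^esub> r"
      using a_rcos_self[OF r] by (rule someI)
    then obtain p where p: "p \<in> m" "(SOME s. s \<in> m +>\<^bsub>R\<^esub> r) = p \<oplus>\<^bsub>R\<^esub> r"
      unfolding a_r_coset_def' by auto
    then show ?thesis
      unfolding g_def p(2) using r v Icarr[OF p(1)] M.smult_closed
      by (simp add: M.smult_l_distr)
  qed
  have g_closed: "g n \<in> carrier M" if "n \<in> carrier N" for n
    using that v M.smult_closed by (auto simp: N_carrier g)
  have g_add: "g (n \<oplus>\<^bsub>N\<^esub> n') = g n \<oplus>\<^bsub>M\<^esub> g n'" if "n \<in> carrier N" "n' \<in> carrier N" for n n'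
    using that v by (auto simp: N_carrier N_add g M.smult_l_distr)
  have g_smult: "g (r \<odot>\<^bsub>N\<^esub> n) = \<phi> r \<odot>\<^bsub>M\<^esub> g n" if "r \<in> carrier R" "n \<in> carrier N" for r n
    using that v by (auto simp: N_carrier N_smult g M.smult_assoc)
  obtain \<Phi> where "\<Phi> \<in> hom (free_Abelian_group (carrier A \<times> carrier N)) (add_monoid M)"
    and \<Phi>_frag': "\<And>x. x \<in> carrier A \<times> carrier N \<Longrightarrow> \<Phi> (frag_of x) = (\<lambda>(b, n). b \<odot>\<^bsub>M\<^esub> g n) x"
    by (rule comm_group.free_Abelian_group_universal[OF M.M.a_comm_group, of "\<lambda>(b, n). b \<odot>\<^bsub>M\<^esub> g n" "carrier A \<times> carrier N"])
      (use g_closed M.smult_closed in auto)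
  then interpret \<Phi>: group_hom F "add_monoid M" \<Phi>
    using comm_group_F
    by (auto simp: group_hom_def group_hom_axioms_def F_def comm_group_def M.M.add.is_group)
  have \<Phi>_frag: "\<Phi> (frag_of (b, n)) = b \<odot>\<^bsub>M\<^esub> g n" if "b \<in> carrier A" "n \<in> carrier N" for b n
    using that \<Phi>_frag'[of "(b, n)"] by simp
  have \<Phi>_diff: "\<Phi> (x - y) = \<zero>\<^bsub>M\<^esub>" if "x \<in> carrier F" "y \<in> carrier F" "\<Phi> x = \<Phi> y" for x y
  proof -
    have "\<Phi> (x - y) \<oplus>\<^bsub>M\<^esub> \<Phi> y = \<Phi> y"
      using \<Phi>.hom_mult[OF F_closed(2)[OF that(1,2)] that(2)] that(3) by simp
    then show ?thesis
      using \<Phi>.hom_closed[OF that(2)] \<Phi>.hom_closed[OF F_closed(2)[OF that(1,2)]] by simp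
  qed
  have "tensor_rels A R \<phi> N \<subseteq> kernel F (add_monoid M) \<Phi>"
  proof
    fix x assume x: "x \<in> tensor_rels A R \<phi> N"
    then have "\<Phi> x = \<zero>\<^bsub>M\<^esub>"
    proof (cases rule: tensor_rels_cases)
      case add: (add_left b b' n)
      have "\<Phi> (frag_of (b, n) + frag_of (b', n)) = \<Phi> (frag_of (b \<oplus>\<^bsub>A\<^esub> b', n))"
        using add \<Phi>.hom_mult[of "frag_of (b, n)" "frag_of (b', n)"] g_closed
        by (simp add: frag_of_mem_F \<Phi>_frag M.smult_l_distr)
      then show ?thesis
        using add by (auto simp: diff_diff_eq frag_of_mem_F intro!: \<Phi>_diff F_closed)
    next
      case add': (add_right b n n')
      have n: "n \<oplus>\<^bsub>N\<^esub> n' \<in> carrier N"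
        using add' N_closed by simp
      have "\<Phi> (frag_of (b, n) + frag_of (b, n')) = \<Phi> (frag_of (b, n \<oplus>\<^bsub>N\<^esub> n'))"
        using add' n \<Phi>.hom_mult[of "frag_of (b, n)" "frag_of (b, n')"] g_closed
        by (simp add: frag_of_mem_F \<Phi>_frag M.smult_r_distr g_add)
      then show ?thesis
        using add' n by (auto simp: diff_diff_eq frag_of_mem_F intro!: \<Phi>_diff F_closed)
    next
      case bal: (balanced b r n)
      have n: "r \<odot>\<^bsub>N\<^esub> n \<in> carrier N"
        using bal N_closed by simp
      have "\<Phi> (frag_of (b \<otimes>\<^bsub>A\<^esub> \<phi> r, n)) = \<Phi> (frag_of (b, r \<odot>\<^bsub>N\<^esub> n))"
        using bal n g_closed by (simp add: \<Phi>_frag M.smult_assoc g_smult)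
      then show ?thesis
        using bal n by (auto simp: frag_of_mem_F intro!: \<Phi>_diff)
    qed
    then show "x \<in> kernel F (add_monoid M) \<Phi>"
      using x tensor_rels_closed by (auto simp: kernel_def)
  qed
  then have "K \<subseteq> kernel F (add_monoid M) \<Phi>"
    unfolding K_def
    by (rule group.generate_subgroup_incl[OF comm_group.axioms(2)[OF comm_group_F] _ \<Phi>.subgroup_kernel])
  \<comment> \<open>The zero of the quotient is K itself, so vanishing of \<open>\<theta> a\<close>
    places its representative in K.\<close>
  moreover have "frag_of (a, m +>\<^bsub>R\<^esub> \<one>\<^bsub>R\<^esub>) \<in> K"
    using a(2) K.rcos_self[OF _ subgroup_K, of "frag_of (a, m +>\<^bsub>R\<^esub> \<one>\<^bsub>R\<^esub>)"] a(1)
    unfolding \<theta>_def U_simps by (simp add: frag_of_mem_F)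
  ultimately have "\<Phi> (frag_of (a, m +>\<^bsub>R\<^esub> \<one>\<^bsub>R\<^esub>)) = \<zero>\<^bsub>M\<^esub>"
    by (auto simp: kernel_def)
  then show ?thesis
    using a(1) v(1) by (simp add: \<Phi>_frag g M.smult_one)
qed

end

section \<open>Polynomials in an endomorphism\<close>

locale module_endomorphism = module R M
  for R :: "('a, 'c) ring_scheme" (structure) and M :: "('a, 'b, 'd) module_scheme" (structure) +
  fixes T :: "'b \<Rightarrow> 'b"
  assumes T_closed [simp, intro]: "v \<in> carrier M \<Longrightarrow> T v \<in> carrier M"
    and T_add: "v \<in> carrier M \<Longrightarrow> w \<in> carrier M \<Longrightarrow> T (v \<oplus>\<^bsub>M\<^esub> w) = T v \<oplus>\<^bsub>M\<^esub> T w"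
    and T_smult: "a \<in> carrier R \<Longrightarrow> v \<in> carrier M \<Longrightarrow> T (a \<odot>\<^bsub>M\<^esub> v) = a \<odot>\<^bsub>M\<^esub> T v"
begin

text \<open>The list has its leading coefficient first, so the sum uses \<open>R.coeff p j\<close>,
  the coefficient of X^j, rather than list positions.\<close>

definition poly_act :: "'a list \<Rightarrow> 'b \<Rightarrow> 'b"
  where "poly_act p v = finsum M (\<lambda>j. R.coeff p j \<odot>\<^bsub>M\<^esub> (T ^^ j) v) {..<length p}"

lemma T_pow_closed [simp, intro]: "v \<in> carrier M \<Longrightarrow> (T ^^ n) v \<in> carrier M"
  by (induction n) auto

lemma T_pow_add: "v \<in> carrier M \<Longrightarrow> w \<in> carrier M \<Longrightarrow>
    (T ^^ n) (v \<oplus>\<^bsub>M\<^esub> w) = (T ^^ n) v \<oplus>\<^bsub>M\<^esub> (T ^^ n) w"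
  by (induction n) (simp_all add: T_add)

lemma T_pow_smult: "a \<in> carrier R \<Longrightarrow> v \<in> carrier M \<Longrightarrow>
    (T ^^ n) (a \<odot>\<^bsub>M\<^esub> v) = a \<odot>\<^bsub>M\<^esub> (T ^^ n) v"
  by (induction n) (simp_all add: T_smult)

lemma poly_act_Nil [simp]: "poly_act [] v = \<zero>\<^bsub>M\<^esub>"
  by (simp add: poly_act_def)

lemma poly_act_closed [simp, intro]:
  "set p \<subseteq> carrier R \<Longrightarrow> v \<in> carrier M \<Longrightarrow> poly_act p v \<in> carrier M"
  unfolding poly_act_def by (rule M.finsum_closed) (simp add: Pi_def)

text \<open>Beyond the length of the list \<open>R.coeff\<close> is zero. Padding to a common range
  lets lists of different lengths be compared and added.\<close>

lemma poly_act_upto: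
  assumes "set p \<subseteq> carrier R" "v \<in> carrier M" "length p \<le> n"
  shows "finsum M (\<lambda>j. R.coeff p j \<odot>\<^bsub>M\<^esub> (T ^^ j) v) {..<n} = poly_act p v"
  using assms(3)
proof (induction n rule: dec_induct)
  case base
  show ?case by (simp add: poly_act_def)
next
  case (step n)
  have "finsum M (\<lambda>j. R.coeff p j \<odot>\<^bsub>M\<^esub> (T ^^ j) v) {..<Suc n} =
      R.coeff p n \<odot>\<^bsub>M\<^esub> (T ^^ n) v \<oplus>\<^bsub>M\<^esub>
      finsum M (\<lambda>j. R.coeff p j \<odot>\<^bsub>M\<^esub> (T ^^ j) v) {..<n}"
    unfolding lessThan_Suc using assms(1,2) by (intro M.finsum_insert) (simp_all add: Pi_def)
  then show ?case
    using step assms by (simp add: R.coeff_length)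
qed

lemma poly_act_eq_if_coeff_eq:
  assumes "set p \<subseteq> carrier R" "set q \<subseteq> carrier R" "v \<in> carrier M" "R.coeff p = R.coeff q"
  shows "poly_act p v = poly_act q v"
  using poly_act_upto[OF assms(1,3), of "max (length p) (length q)"]
    poly_act_upto[OF assms(2,3), of "max (length p) (length q)"] assms(4) by simp

lemma poly_act_normalize:
  "set p \<subseteq> carrier R \<Longrightarrow> v \<in> carrier M \<Longrightarrow> poly_act (R.normalize p) v = poly_act p v"
  by (rule poly_act_eq_if_coeff_eq)
    (use R.normalize_in_carrier R.normalize_coeff in \<open>simp_all flip: R.normalize_coeff\<close>)

lemma poly_act_poly_add:
  assumes "set p \<subseteq> carrier R" "set q \<subseteq> carrier R" "v \<in> carrier M"
  shows "poly_act (R.poly_add p q) v = poly_act p v \<oplus>\<^bsub>M\<^esub> poly_act q v"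
proof -
  let ?n = "max (length p) (length q)"
  let ?f = "\<lambda>p j. R.coeff p j \<odot>\<^bsub>M\<^esub> (T ^^ j) v"
  have "poly_act (R.poly_add p q) v = finsum M (?f (R.poly_add p q)) {..<?n}"
    using assms R.poly_add_length_le by (intro poly_act_upto[symmetric] R.poly_add_in_carrier)
  also have "\<dots> = finsum M (\<lambda>j. ?f p j \<oplus>\<^bsub>M\<^esub> ?f q j) {..<?n}"
    using assms by (intro M.finsum_cong') (simp_all add: R.poly_add_coeff smult_l_distr Pi_def del: R.poly_add.simps)
  also have "\<dots> = finsum M (?f p) {..<?n} \<oplus>\<^bsub>M\<^esub> finsum M (?f q) {..<?n}"
    using assms by (intro M.finsum_addf) (simp_all add: Pi_def)
  finally show ?thesis
    using assms by (simp add: poly_act_upto)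
qed

lemma poly_act_Cons:
  assumes "a \<in> carrier R" "set p \<subseteq> carrier R" "v \<in> carrier M"
  shows "poly_act (a # p) v = a \<odot>\<^bsub>M\<^esub> (T ^^ length p) v \<oplus>\<^bsub>M\<^esub> poly_act p v"
proof -
  have "poly_act (a # p) v = R.coeff (a # p) (length p) \<odot>\<^bsub>M\<^esub> (T ^^ length p) v \<oplus>\<^bsub>M\<^esub>
      finsum M (\<lambda>j. R.coeff (a # p) j \<odot>\<^bsub>M\<^esub> (T ^^ j) v) {..<length p}"
    unfolding poly_act_def list.size add_0_right add_Suc_right lessThan_Suc
    using assms by (intro M.finsum_insert) (simp_all add: Pi_def)
  also have "finsum M (\<lambda>j. R.coeff (a # p) j \<odot>\<^bsub>M\<^esub> (T ^^ j) v) {..<length p} = poly_act p v"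
    unfolding poly_act_def using assms by (intro M.finsum_cong') (simp_all add: Pi_def)
  finally show ?thesis by simp
qed

lemma poly_act_replicate_zero: "v \<in> carrier M \<Longrightarrow> poly_act (replicate n \<zero>\<^bsub>R\<^esub>) v = \<zero>\<^bsub>M\<^esub>"
  using poly_act_eq_if_coeff_eq[of "replicate n \<zero>\<^bsub>R\<^esub>" "[]" v]
  by (auto simp: fun_eq_iff set_replicate_conv_if)

text \<open>The list represents a X^n p: the appended zeros shift the degrees by n. Such lists are
  the summands in the recursion of \<open>R.poly_mult\<close>.\<close>

lemma poly_act_monomial_mult:
  assumes "a \<in> carrier R" "v \<in> carrier M"
  shows "set p \<subseteq> carrier R \<Longrightarrow>
    poly_act (map ((\<otimes>\<^bsub>R\<^esub>) a) p @ replicate n \<zero>\<^bsub>R\<^esub>) v = a \<odot>\<^bsub>M\<^esub> (T ^^ n) (poly_act p v)"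
proof (induction p)
  case Nil
  have "(T ^^ n) \<zero>\<^bsub>M\<^esub> = \<zero>\<^bsub>M\<^esub>"
    using T_pow_smult[of "\<zero>\<^bsub>R\<^esub>" "\<zero>\<^bsub>M\<^esub>" n] by simp
  then show ?case
    using assms by (simp add: poly_act_replicate_zero)
next
  case (Cons b p)
  have *: "set (map ((\<otimes>\<^bsub>R\<^esub>) a) p @ replicate n \<zero>\<^bsub>R\<^esub>) \<subseteq> carrier R"
    using assms(1) Cons.prems by auto
  have "poly_act (map ((\<otimes>\<^bsub>R\<^esub>) a) (b # p) @ replicate n \<zero>\<^bsub>R\<^esub>) v =
      (a \<otimes>\<^bsub>R\<^esub> b) \<odot>\<^bsub>M\<^esub> (T ^^ (length p + n)) v \<oplus>\<^bsub>M\<^esub> a \<odot>\<^bsub>M\<^esub> (T ^^ n) (poly_act p v)"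
    using poly_act_Cons[OF _ * assms(2), of "a \<otimes>\<^bsub>R\<^esub> b"] assms Cons by simp
  also have "(T ^^ (length p + n)) v = (T ^^ n) ((T ^^ length p) v)"
    by (simp add: funpow_add add.commute)
  also have "(a \<otimes>\<^bsub>R\<^esub> b) \<odot>\<^bsub>M\<^esub> (T ^^ n) ((T ^^ length p) v) =
      a \<odot>\<^bsub>M\<^esub> (T ^^ n) (b \<odot>\<^bsub>M\<^esub> (T ^^ length p) v)"
    using assms Cons.prems by (simp add: smult_assoc1 T_pow_smult)
  finally show ?case
    using assms Cons.prems by (simp add: poly_act_Cons T_pow_add smult_r_distr)
qed

lemma poly_act_poly_mult:
  assumes "set q \<subseteq> carrier R" "v \<in> carrier M"
  shows "set p \<subseteq> carrier R \<Longrightarrow> poly_act (R.poly_mult p q) v = poly_act p (poly_act q v)"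
proof (induction p)
  case (Cons a p)
  then have a: "a \<in> carrier R" and p: "set p \<subseteq> carrier R" by auto
  have *: "set (map ((\<otimes>\<^bsub>R\<^esub>) a) q @ replicate (length p) \<zero>\<^bsub>R\<^esub>) \<subseteq> carrier R"
    using assms(1) a by auto
  have "poly_act (R.poly_mult (a # p) q) v =
      poly_act (map ((\<otimes>\<^bsub>R\<^esub>) a) q @ replicate (length p) \<zero>\<^bsub>R\<^esub>) v \<oplus>\<^bsub>M\<^esub> poly_act (R.poly_mult p q) v"
    using poly_act_poly_add[OF * R.poly_mult_in_carrier[OF p assms(1)] assms(2)] by simp
  then show ?case
    using Cons.IH[OF p] a p assms by (simp add: poly_act_monomial_mult poly_act_Cons)
qed simp

lemma poly_ring_set: "p \<in> carrier (poly_ring R) \<Longrightarrow> set p \<subseteq> carrier R"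
  using R.polynomial_in_carrier[OF R.carrier_is_subring] by (simp add: univ_poly_carrier)

lemma poly_act_add: "p \<in> carrier (poly_ring R) \<Longrightarrow> q \<in> carrier (poly_ring R) \<Longrightarrow> v \<in> carrier M \<Longrightarrow>
    poly_act (p \<oplus>\<^bsub>poly_ring R\<^esub> q) v = poly_act p v \<oplus>\<^bsub>M\<^esub> poly_act q v"
  using poly_act_poly_add poly_ring_set by (simp add: univ_poly_add)

lemma poly_act_mult: "p \<in> carrier (poly_ring R) \<Longrightarrow> q \<in> carrier (poly_ring R) \<Longrightarrow> v \<in> carrier M \<Longrightarrow>
    poly_act (p \<otimes>\<^bsub>poly_ring R\<^esub> q) v = poly_act p (poly_act q v)"
  using poly_act_poly_mult poly_ring_set by (simp add: univ_poly_mult)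

lemma poly_act_one: "v \<in> carrier M \<Longrightarrow> poly_act \<one>\<^bsub>poly_ring R\<^esub> v = v"
  using poly_act_Cons[of "\<one>\<^bsub>R\<^esub>" "[]" v] by (simp add: univ_poly_one)

definition annihilator :: "'b \<Rightarrow> 'a list set"
  where "annihilator v = {p \<in> carrier (poly_ring R). poly_act p v = \<zero>\<^bsub>M\<^esub>}"

lemma poly_act_commute:
  assumes "domain R" "p \<in> carrier (poly_ring R)" "q \<in> carrier (poly_ring R)" "v \<in> carrier M"
  shows "poly_act p (poly_act q v) = poly_act q (poly_act p v)"
proof -
  interpret UP: cring "poly_ring R"
    by (rule domain.univ_poly_is_cring[OF assms(1) R.carrier_is_subring])
  show ?thesis
    using assms by (simp add: UP.m_comm flip: poly_act_mult)
qed

end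

text \<open>Commutativity of the action turns cyclicity of every nonzero vector into primality of the
  annihilator.\<close>

lemma annihilator_prime_generator:
  assumes "field R" and "module_endomorphism R M T"
    and v: "v \<in> carrier M" "v \<noteq> \<zero>\<^bsub>M\<^esub>"
    and cyclic: "\<And>w. w \<in> carrier M \<Longrightarrow> w \<noteq> \<zero>\<^bsub>M\<^esub> \<Longrightarrow>
      \<exists>p\<in>carrier (poly_ring R). module_endomorphism.poly_act R M T p w = v"
  obtains g where "g \<in> carrier (poly_ring R)" "Polynomials.lead_coeff g = \<one>\<^bsub>R\<^esub>"
    "pirreducible\<^bsub>R\<^esub> (carrier R) g"
    "module_endomorphism.annihilator R M T v = PIdl\<^bsub>poly_ring R\<^esub> g"
proof -
  interpret R: field R by fact
  interpret module_endomorphism R M T by fact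
  interpret UP: principal_domain "poly_ring R"
    by (rule R.univ_poly_is_principal[OF R.carrier_is_subfield])
  let ?I = "annihilator v"
  \<comment> \<open>The zero polynomial is the empty list and acts as zero, so commuting p past it
    shows that p kills the zero vector.\<close>
  have zero: "poly_act p \<zero>\<^bsub>M\<^esub> = \<zero>\<^bsub>M\<^esub>" if "p \<in> carrier (poly_ring R)" for p
    using poly_act_commute[OF R.domain_axioms that UP.zero_closed M.zero_closed] by (simp add: univ_poly_zero)
  have ideal: "ideal ?I (poly_ring R)"
  proof (rule idealI[OF UP.ring_axioms])
    have "\<ominus>\<^bsub>poly_ring R\<^esub> p \<in> ?I" if "p \<in> ?I" for p
      using that v(1) poly_act_add[of "\<ominus>\<^bsub>poly_ring R\<^esub> p" p v] poly_ring_set[of "\<ominus>\<^bsub>poly_ring R\<^esub> p"]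
      unfolding annihilator_def by (simp add: UP.l_neg univ_poly_zero)
    then show "subgroup ?I (add_monoid (poly_ring R))"
      using v(1) UP.zero_closed
      by (intro UP.add.subgroupI) (auto simp: annihilator_def poly_act_add a_inv_def univ_poly_zero)
    fix a x assume ax: "a \<in> ?I" "x \<in> carrier (poly_ring R)"
    then show "x \<otimes>\<^bsub>poly_ring R\<^esub> a \<in> ?I"
      using v(1) zero by (simp add: annihilator_def poly_act_mult)
    then show "a \<otimes>\<^bsub>poly_ring R\<^esub> x \<in> ?I"
      using ax by (simp add: UP.m_comm annihilator_def)
  qed
  have "?I \<noteq> {[]}"
  proof
    assume *: "?I = {[]}"
    \<comment> \<open>The list of the polynomial X. If the annihilator were zero, X v would be
      nonzero and p X v = v for some p; then p X - 1 kills v, so p X = 1 and X would be a unit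
      although it is not constant.\<close>
    let ?X = "[\<one>\<^bsub>R\<^esub>, \<zero>\<^bsub>R\<^esub>]"
    have X: "?X \<in> carrier (poly_ring R)"
      by (simp add: polynomial_def flip: univ_poly_carrier)
    have "poly_act ?X v \<noteq> \<zero>\<^bsub>M\<^esub>"
      using * X by (auto simp: annihilator_def)
    then obtain p where p: "p \<in> carrier (poly_ring R)" "poly_act p (poly_act ?X v) = v"
      using cyclic[of "poly_act ?X v"] poly_act_closed[OF poly_ring_set[OF X] v(1)] by blast
    let ?q = "p \<otimes>\<^bsub>poly_ring R\<^esub> ?X"
    have q: "?q \<in> carrier (poly_ring R)" "poly_act ?q v = v"
      using p X v by (simp_all add: poly_act_mult)
    have "poly_act (?q \<ominus>\<^bsub>poly_ring R\<^esub> \<one>\<^bsub>poly_ring R\<^esub>) v \<oplus>\<^bsub>M\<^esub> v = v"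
      using poly_act_add[of "?q \<ominus>\<^bsub>poly_ring R\<^esub> \<one>\<^bsub>poly_ring R\<^esub>" "\<one>\<^bsub>poly_ring R\<^esub>" v] q v(1)
      by (simp add: poly_act_one a_minus_def UP.a_assoc UP.l_neg)
    then have "?q \<ominus>\<^bsub>poly_ring R\<^esub> \<one>\<^bsub>poly_ring R\<^esub> \<in> ?I"
      using q v(1) poly_act_closed[OF poly_ring_set v(1), of "?q \<ominus>\<^bsub>poly_ring R\<^esub> \<one>\<^bsub>poly_ring R\<^esub>"]
      by (simp add: annihilator_def)
    with * have "?q = \<one>\<^bsub>poly_ring R\<^esub>"
      using q(1) UP.r_right_minus_eq by (simp add: univ_poly_zero)
    then have "?X \<in> Units (poly_ring R)"
      using p X UP.m_comm unfolding Units_def by auto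
    then show False
      by (simp add: R.univ_poly_units[OF R.carrier_is_subfield])
  qed
  then obtain g where g: "g \<in> carrier (poly_ring R)" "Polynomials.lead_coeff g = \<one>\<^bsub>R\<^esub>"
      "?I = PIdl\<^bsub>poly_ring R\<^esub> g"
    using R.exists_unique_gen[OF R.carrier_is_subfield ideal] by blast
  have "primeideal ?I (poly_ring R)"
  proof (rule primeidealI[OF ideal UP.is_cring])
    show "carrier (poly_ring R) \<noteq> ?I"
    proof
      assume "carrier (poly_ring R) = ?I"
      then have "\<one>\<^bsub>poly_ring R\<^esub> \<in> ?I"
        using UP.one_closed by simp
      then show False
        using poly_act_one[OF v(1)] v(2) by (simp add: annihilator_def)
    qed
    fix a b assume ab: "a \<in> carrier (poly_ring R)" "b \<in> carrier (poly_ring R)"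
      "a \<otimes>\<^bsub>poly_ring R\<^esub> b \<in> ?I"
    show "a \<in> ?I \<or> b \<in> ?I"
    proof (rule disjCI)
      assume "b \<notin> ?I"
      then obtain p where p: "p \<in> carrier (poly_ring R)" "poly_act p (poly_act b v) = v"
        using cyclic[of "poly_act b v"] poly_act_closed[OF poly_ring_set[OF ab(2)] v(1)] ab(2)
        unfolding annihilator_def by blast
      \<comment> \<open>Since b v is nonzero, some p recovers v = p b v, and then a v = p (a b v) =
        0.\<close>
      have "poly_act a v = poly_act p (poly_act a (poly_act b v))"
        using p ab(1,2) v(1) poly_act_commute[OF R.domain_axioms, of a p "poly_act b v"] poly_ring_set by simp
      then show "a \<in> ?I"
        using ab v(1) zero[OF p(1)] by (simp add: annihilator_def poly_act_mult)
    qed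
  qed
  moreover have "g \<noteq> []"
    using \<open>?I \<noteq> {[]}\<close> g(3) UP.genideal_zero UP.cgenideal_eq_genideal[OF UP.zero_closed]
    by (auto simp: univ_poly_zero)
  ultimately have "pprime\<^bsub>R\<^esub> (carrier R) g"
    using UP.primeideal_iff_prime[of g] g by (simp add: univ_poly_zero)
  then have "pirreducible\<^bsub>R\<^esub> (carrier R) g"
    using R.pprime_iff_pirreducible[OF R.carrier_is_subfield g(1)] by simp
  with g that show thesis by blast
qed

section \<open>Weight modules for a factor of the defining polynomial\<close>

text \<open>The facts that \<open>module_iso_if_same_kernel\<close> asks of its target, together
  with the kernel of the coset map. The scalar action is well defined because J is stable under
  A.\<close>

lemma quot_module_facts:
  assumes "left_module A M" and "submodule J A M"
  shows "abelian_group (quot_module M J)"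
    and "carrier (quot_module M J) = (\<lambda>u. J +>\<^bsub>M\<^esub> u) ` carrier M"
    and "u \<in> carrier M \<Longrightarrow> w \<in> carrier M \<Longrightarrow>
      (J +>\<^bsub>M\<^esub> u) \<oplus>\<^bsub>quot_module M J\<^esub> (J +>\<^bsub>M\<^esub> w) = J +>\<^bsub>M\<^esub> (u \<oplus>\<^bsub>M\<^esub> w)"
    and "a \<in> carrier A \<Longrightarrow> u \<in> carrier M \<Longrightarrow>
      a \<odot>\<^bsub>quot_module M J\<^esub> (J +>\<^bsub>M\<^esub> u) = J +>\<^bsub>M\<^esub> (a \<odot>\<^bsub>M\<^esub> u)"
    and "u \<in> carrier M \<Longrightarrow> J +>\<^bsub>M\<^esub> u = \<zero>\<^bsub>quot_module M J\<^esub> \<longleftrightarrow> u \<in> J"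
proof -
  interpret left_module A M by fact
  interpret J: submodule J A M by fact
  interpret J: abelian_subgroup J M
    by (rule abelian_subgroupI3) (auto simp: additive_subgroup_def J.subgroup_axioms M.abelian_group_axioms)
  show "abelian_group (quot_module M J)"
  proof (rule comm_group_abelian_groupI)
    show "comm_group (add_monoid (quot_module M J))"
      using J.a_factorgroup_is_comm_group
      by (simp add: quot_module_def A_FactGroup_def' comm_group_truncate)
  qed
  show "carrier (quot_module M J) = (\<lambda>u. J +>\<^bsub>M\<^esub> u) ` carrier M"
    by (auto simp: quot_module_simps A_RCOSETS_def')
  show "(J +>\<^bsub>M\<^esub> u) \<oplus>\<^bsub>quot_module M J\<^esub> (J +>\<^bsub>M\<^esub> w) = J +>\<^bsub>M\<^esub> (u \<oplus>\<^bsub>M\<^esub> w)"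
    if "u \<in> carrier M" "w \<in> carrier M"
    using that by (simp add: quot_module_simps J.a_rcos_sum)
  show "a \<odot>\<^bsub>quot_module M J\<^esub> (J +>\<^bsub>M\<^esub> u) = J +>\<^bsub>M\<^esub> (a \<odot>\<^bsub>M\<^esub> u)"
    if au: "a \<in> carrier A" "u \<in> carrier M"
  proof -
    have "J +>\<^bsub>M\<^esub> (a \<odot>\<^bsub>M\<^esub> t) = J +>\<^bsub>M\<^esub> (a \<odot>\<^bsub>M\<^esub> u)" if t: "t \<in> J +>\<^bsub>M\<^esub> u" for t
    proof -
      obtain x where x: "x \<in> J" "t = x \<oplus>\<^bsub>M\<^esub> u"
        using t by (auto simp: a_r_coset_def')
      then have "a \<odot>\<^bsub>M\<^esub> t = a \<odot>\<^bsub>M\<^esub> x \<oplus>\<^bsub>M\<^esub> a \<odot>\<^bsub>M\<^esub> u" "a \<odot>\<^bsub>M\<^esub> x \<in> J"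
        using au J.a_Hcarr by (simp_all add: smult_r_distr)
      then have "a \<odot>\<^bsub>M\<^esub> t \<in> J +>\<^bsub>M\<^esub> (a \<odot>\<^bsub>M\<^esub> u)"
        unfolding a_r_coset_def' by auto
      then show ?thesis
        by (rule M.a_repr_independence[symmetric])
          (use au smult_closed in \<open>auto intro: J.a_subgroup\<close>)
    qed
    moreover have "u \<in> J +>\<^bsub>M\<^esub> u"
      by (rule J.a_rcos_self[OF au(2)])
    ultimately have "(\<Union>t\<in>J +>\<^bsub>M\<^esub> u. J +>\<^bsub>M\<^esub> (a \<odot>\<^bsub>M\<^esub> t)) = J +>\<^bsub>M\<^esub> (a \<odot>\<^bsub>M\<^esub> u)"
      by blast
    then show ?thesis
      by (simp add: quot_module_simps)
  qed
  show "J +>\<^bsub>M\<^esub> u = \<zero>\<^bsub>quot_module M J\<^esub> \<longleftrightarrow> u \<in> J" if "u \<in> carrier M"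
    using that J.a_rcos_self[OF that] J.a_rcos_const[of u] by (auto simp: quot_module_simps)
qed

lemma cyclic_induction_Ah:
  assumes "ideal m (polyR :: 'f::field poly ring)"
  shows "cyclic_induction polyR (Ah h) (Ah_poly h) m"
proof -
  have "ring_hom_ring polyR (Ah h) (Ah_poly h)"
    by (rule ring_hom_ringI2)
      (auto simp: ring_hom_def Ah_poly_add Ah_poly_mult Ah_poly_one
        polyR.ring_axioms Ah.ring_axioms)
  then show ?thesis
    using assms by (simp add: cyclic_induction_def)
qed

lemma U_module_eq:
  assumes "ideal m (polyR :: 'f::field poly ring)"
  shows "U_module h m = cyclic_induction.U polyR (Ah h) (Ah_poly h) m"
  using cyclic_induction_Ah[OF assms, of h]
  by (simp add: U_module_def cyclic_induction.U_def cyclic_induction.N_def)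

context cyclic_induction
begin

lemma \<theta>_eq_imp:
  assumes M: "left_module A M" and v: "v \<in> carrier M" "\<And>p. p \<in> m \<Longrightarrow> \<phi> p \<odot>\<^bsub>M\<^esub> v = \<zero>\<^bsub>M\<^esub>"
    and ab: "a \<in> carrier A" "b \<in> carrier A" "\<theta> a = \<theta> b"
  shows "a \<odot>\<^bsub>M\<^esub> v = b \<odot>\<^bsub>M\<^esub> v"
proof -
  interpret M: left_module A M by fact
  have a: "a_minus A a b \<oplus>\<^bsub>A\<^esub> b = a"
    using ab by (simp add: a_minus_def hom.S.a_assoc hom.S.l_neg)
  have "\<theta> (a_minus A a b) \<oplus>\<^bsub>U\<^esub> \<theta> b = \<theta> b"
    using \<theta>_add[OF hom.S.minus_closed[OF ab(1,2)] ab(2)] unfolding a ab(3) by (rule sym)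
  then have "\<theta> (a_minus A a b) = \<zero>\<^bsub>U\<^esub>"
    using \<theta>_closed[OF hom.S.minus_closed[OF ab(1,2)]] \<theta>_closed[OF ab(2)] by simp
  then have "a_minus A a b \<odot>\<^bsub>M\<^esub> v = \<zero>\<^bsub>M\<^esub>"
    using ab(1,2) by (intro \<theta>_eq_zero_imp[OF M v hom.S.minus_closed])
  moreover have "a \<odot>\<^bsub>M\<^esub> v = a_minus A a b \<odot>\<^bsub>M\<^esub> v \<oplus>\<^bsub>M\<^esub> b \<odot>\<^bsub>M\<^esub> v"
    using ab v M.smult_l_distr[of "a_minus A a b" b v] a by simp
  ultimately show ?thesis
    using ab v M.smult_closed by simp
qed

end

section \<open>Modules over the residue field R/m\<close>

definition residue_field :: "'f::field poly \<Rightarrow> 'f poly set ring"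
  where "residue_field f = polyR Quot (PIdl\<^bsub>polyR\<^esub> f)"

text \<open>The reduction modulo f of the element \<open>y_comb h n r\<close>. The index list is
  reversed because leading coefficients come first, and \<open>ring.normalize\<close> removes
  leading coefficients that f divides.\<close>

definition y_poly :: "'f::field poly \<Rightarrow> nat \<Rightarrow> (nat \<Rightarrow> 'f poly) \<Rightarrow> 'f poly set list"
  where "y_poly f n r = ring.normalize (residue_field f)
    (map (\<lambda>j. PIdl\<^bsub>polyR\<^esub> f +>\<^bsub>polyR\<^esub> r j) (rev [0..<n]))"

lemma mem_coset_PIdl: "p \<in> PIdl\<^bsub>polyR\<^esub> f +>\<^bsub>polyR\<^esub> q \<longleftrightarrow> f dvd p - q"
proof
  assume "f dvd p - q"
  then show "p \<in> PIdl\<^bsub>polyR\<^esub> f +>\<^bsub>polyR\<^esub> q"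
    unfolding a_r_coset_def' by (auto simp: mem_PIdl_polyR intro!: bexI[of _ "p - q"])
qed (auto simp: a_r_coset_def' mem_PIdl_polyR)

text \<open>If f divides h and kills M, then M is a module over the commutative ring (R/m)[y]. Both
  V and U(m) become instances, which is what allows their comparison.\<close>

locale weight_module = Ah_module h M
  for h :: "'f::field poly" and M :: "('f free_alg set, 'v, 'd) module_scheme" (structure) +
  fixes f :: "'f poly"
  assumes max: "maximalideal (PIdl\<^bsub>polyR\<^esub> f) polyR"
    and f_dvd: "f dvd h"
    and f_act: "v \<in> carrier M \<Longrightarrow> p_act f v = \<zero>\<^bsub>M\<^esub>"
begin

abbreviation coset :: "'f poly \<Rightarrow> 'f poly set"
  where "coset p \<equiv> PIdl\<^bsub>polyR\<^esub> f +>\<^bsub>polyR\<^esub> p"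

definition residue_module :: "('f poly set, 'v) module"
  where "residue_module =
    \<lparr>carrier = carrier M, monoid.mult = undefined, one = undefined,
     ring.zero = \<zero>\<^bsub>M\<^esub>, add = add M, module.smult = (\<lambda>c v. p_act (SOME p. p \<in> c) v)\<rparr>"

lemma residue_module_simps [simp]:
  "carrier residue_module = carrier M" "\<zero>\<^bsub>residue_module\<^esub> = \<zero>\<^bsub>M\<^esub>"
  "v \<oplus>\<^bsub>residue_module\<^esub> w = v \<oplus>\<^bsub>M\<^esub> w"
  by (simp_all add: residue_module_def)

lemma p_act_cong: "f dvd p - q \<Longrightarrow> v \<in> carrier M \<Longrightarrow> p_act p v = p_act q v"
  using p_act_add[of v "p - q" q] p_act_dvd[OF _ f_act, of v "p - q"] by simp

lemma some_rep:
  assumes "v \<in> carrier M"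
  shows "p_act (SOME q. q \<in> coset p) v = p_act p v"
proof -
  have "p \<in> coset p"
    by (simp add: mem_coset_PIdl)
  then have "(SOME q. q \<in> coset p) \<in> coset p"
    by (rule someI)
  then show ?thesis
    using assms by (intro p_act_cong) (simp_all add: mem_coset_PIdl)
qed

lemma residue_smult: "v \<in> carrier M \<Longrightarrow> coset p \<odot>\<^bsub>residue_module\<^esub> v = p_act p v"
  using some_rep by (simp add: residue_module_def)

lemma field_residue_field: "field (residue_field f)"
  unfolding residue_field_def by (rule maximalideal.quotient_is_field[OF max cring_polyR])

sublocale residue: field "residue_field f"
  by (rule field_residue_field)

lemma carrier_residue_field: "carrier (residue_field f) = range coset"
  by (auto simp: residue_field_def FactRing_def A_RCOSETS_def')

lemma coset_hom: "coset \<in> ring_hom polyR (residue_field f)"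
  unfolding residue_field_def using max by (intro ideal.rcos_ring_hom maximalideal.axioms(1))

lemma residue_field_simps:
  "coset p \<oplus>\<^bsub>residue_field f\<^esub> coset q = coset (p + q)"
  "coset p \<otimes>\<^bsub>residue_field f\<^esub> coset q = coset (p * q)"
  "\<one>\<^bsub>residue_field f\<^esub> = coset 1"
  using coset_hom by (simp_all add: ring_hom_def)

text \<open>The commutator of y with p is h p', a multiple of f, and so acts as zero. Hence y acts
  as an R/m-linear endomorphism.\<close>

lemma p_act_y_act_commute: "v \<in> carrier M \<Longrightarrow> y_act (p_act p v) = p_act p (y_act v)"
  using p_act_dvd[OF _ f_act, of v "- (h * pderiv p)"] f_dvd by (simp add: p_act_y_act)

sublocale E: module_endomorphism "residue_field f" residue_module y_act
proof -
  have "abelian_group residue_module"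
    using M.add.inv_closed
    by (intro abelian_groupI) (auto simp: M.a_ac intro: M.l_neg)
  then have "module (residue_field f) residue_module"
    using residue.cring_axioms
    by (intro moduleI)
      (auto simp: carrier_residue_field residue_smult residue_field_simps p_act_add p_act_mult
        smult_r_distr)
  then show "module_endomorphism (residue_field f) residue_module y_act"
    by (auto simp: module_endomorphism_def module_endomorphism_axioms_def carrier_residue_field
        residue_smult smult_r_distr p_act_y_act_commute)
qed

lemma y_pow_p_act: "v \<in> carrier M \<Longrightarrow> y_pow n (p_act p v) = p_act p ((y_act ^^ n) v)"
proof (induction n)
  case 0
  then show ?case by (simp add: smult_one)
next
  case (Suc n)
  then have "y_pow (Suc n) (p_act p v) = y_act (p_act p ((y_act ^^ n) v))"
    by (simp only: y_pow_Suc smult_closed Ah_poly_closed)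
  then show ?case
    using Suc E.T_pow_closed[of v n] by (simp add: p_act_y_act_commute)
qed

text \<open>On a module killed by f it does not matter which representatives the lift has chosen,
  and y may be moved past the coefficients.\<close>

lemma poly_lift_smult:
  assumes "v \<in> carrier M"
  shows "set G \<subseteq> carrier (residue_field f) \<Longrightarrow>
    poly_lift h (PIdl\<^bsub>polyR\<^esub> f) G \<odot>\<^bsub>M\<^esub> v = E.poly_act G v"
proof (induction G)
  case Nil
  show ?case
    using assms by (simp add: poly_lift_def)
next
  case (Cons c G)
  let ?r = "\<lambda>G j. SOME p. p \<in> residue.coeff G j"
  obtain p where c: "c = coset p"
    using Cons.prems by (auto simp: carrier_residue_field)
  have eq: "poly_lift h (PIdl\<^bsub>polyR\<^esub> f) G = y_comb h (length G) (?r G)" for G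
    by (simp add: poly_lift_def y_comb_def residue_field_def)
  \<comment> \<open>The coefficients of \<open>c # G\<close> in degrees below
    \<open>length G\<close> are those of \<open>G\<close>, so the new head only adds the top
    term.\<close>
  have "y_comb h (length G) (?r (c # G)) = poly_lift h (PIdl\<^bsub>polyR\<^esub> f) G"
    unfolding eq by (rule y_comb_cong) simp
  then have "poly_lift h (PIdl\<^bsub>polyR\<^esub> f) (c # G) \<odot>\<^bsub>M\<^esub> v =
      y_pow (length G) (p_act (?r (c # G) (length G)) v) \<oplus>\<^bsub>M\<^esub> poly_lift h (PIdl\<^bsub>polyR\<^esub> f) G \<odot>\<^bsub>M\<^esub> v"
    using assms unfolding eq[of "c # G"] by (simp add: y_comb_smult_Suc del: residue.coeff.simps)
  also have "y_pow (length G) (p_act (?r (c # G) (length G)) v) = p_act p ((y_act ^^ length G) v)"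
    using assms by (simp add: y_pow_p_act c some_rep)
  finally show ?case
    using Cons assms E.T_pow_closed[of v "length G"] E.poly_act_Cons[of c G v]
    by (simp add: c residue_smult carrier_residue_field)
qed

lemma y_poly_closed: "y_poly f n r \<in> carrier (poly_ring (residue_field f))"
  unfolding y_poly_def univ_poly_carrier[symmetric]
  by (rule residue.normalize_gives_polynomial) (auto simp: carrier_residue_field)

text \<open>The polynomial depends on f, n and r but not on the module, so one polynomial describes
  an element of A_h on V and on U(m) alike.\<close>

lemma y_comb_smult:
  assumes "v \<in> carrier M"
  shows "y_comb h n r \<odot>\<^bsub>M\<^esub> v = E.poly_act (y_poly f n r) v"
proof -
  let ?L = "\<lambda>n. map (\<lambda>j. coset (r j)) (rev [0..<n])"
  have L: "set (?L n) \<subseteq> carrier (residue_field f)" for n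
    by (auto simp: carrier_residue_field)
  have "y_comb h n r \<odot>\<^bsub>M\<^esub> v = E.poly_act (?L n) v"
  proof (induction n)
    case 0
    show ?case using assms by simp
  next
    case (Suc n)
    then show ?case
      using assms E.T_pow_closed[of v n] E.poly_act_Cons[OF _ L, of "coset (r n)" v n]
      by (simp add: y_comb_smult_Suc y_pow_p_act residue_smult carrier_residue_field)
  qed
  then show ?thesis
    unfolding y_poly_def using L assms by (simp add: E.poly_act_normalize)
qed

end

section \<open>Irreducible generalized weight modules\<close>

text \<open>A nonzero vector has a nonzero component, so some generalized weight space is nonzero;
  being a submodule, it is all of V.\<close>

lemma irreducible_gen_weight_module:
  fixes h :: "'f::field poly"
  assumes irr: "irreducible_module (Ah h) V" and gw: "generalized_weight_module h V"
  obtains f v where "maximalideal (PIdl\<^bsub>polyR\<^esub> f) polyR"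
    "carrier V = gen_weight_space h V (PIdl\<^bsub>polyR\<^esub> f)"
    "v \<in> carrier V" "v \<noteq> \<zero>\<^bsub>V\<^esub>" "Ah_poly h f \<odot>\<^bsub>V\<^esub> v = \<zero>\<^bsub>V\<^esub>"
proof -
  interpret left_module "Ah h" V
    using irr by (simp add: irreducible_module_def)
  interpret Ah_module h V
    by unfold_locales
  obtain u where u: "u \<in> carrier V" "u \<noteq> \<zero>\<^bsub>V\<^esub>"
    using irr M.zero_closed unfolding irreducible_module_def by blast
  then obtain c where c: "\<And>n. maximalideal n polyR \<Longrightarrow> c n \<in> gen_weight_space h V n"
      "\<And>n. \<not> maximalideal n polyR \<Longrightarrow> c n = \<zero>\<^bsub>V\<^esub>" "u = finsum V c {n. c n \<noteq> \<zero>\<^bsub>V\<^esub>}"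
    using gw unfolding generalized_weight_module_def internal_direct_sum_def by blast
  have "{n. c n \<noteq> \<zero>\<^bsub>V\<^esub>} \<noteq> {}"
  proof
    assume empty: "{n. c n \<noteq> \<zero>\<^bsub>V\<^esub>} = {}"
    show False
      using c(3) u(2) unfolding empty by simp
  qed
  then obtain n where n: "c n \<noteq> \<zero>\<^bsub>V\<^esub>" "maximalideal n polyR"
    using c(2) by blast
  then obtain f where f: "n = PIdl\<^bsub>polyR\<^esub> f"
    using ideal_polyR_imp_principal maximalideal.axioms(1) by blast
  have "carrier V = gen_weight_space h V (PIdl\<^bsub>polyR\<^esub> f)"
    using irr submodule_gen_weight_space[of f] c(1)[OF n(2)] n(1)
    unfolding irreducible_module_def f by blast
  moreover obtain v where "v \<in> carrier V" "v \<noteq> \<zero>\<^bsub>V\<^esub>" "p_act f v = \<zero>\<^bsub>V\<^esub>"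
    using weight_vector_exists c(1)[OF n(2)] n(1) unfolding f by blast
  ultimately show thesis
    using that n(2) f by blast
qed

text \<open>In characteristic 0 the derivative of a nonconstant f is nonzero and of smaller
  degree.\<close>

lemma irreducible_not_dvd_pderiv:
  fixes f :: "'f::field_char_0 poly"
  assumes "Factorial_Ring.irreducible f"
  shows "\<not> f dvd pderiv f"
proof
  assume dvd: "f dvd pderiv f"
  have "Polynomial.degree f \<noteq> 0"
    using assms by (auto simp: Factorial_Ring.irreducible_def is_unit_iff_degree)
  then have "pderiv f \<noteq> 0"
    by (simp add: pderiv_eq_0_iff)
  then have "Polynomial.degree f \<le> Polynomial.degree (pderiv f)"
    using dvd by (rule dvd_imp_degree_le[rotated])
  with \<open>Polynomial.degree f \<noteq> 0\<close> show False
    by (simp add: degree_pderiv)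
qed

text \<open>The annihilators of v and of 1 \<otimes> 1 agree. If a sum of terms y^j r_j kills v,
  then f divides each r_j, so each y^j r_j \<otimes> 1 vanishes; the converse is the universal
  property.\<close>

lemma module_iso_U_module:
  fixes h f :: "'f::field poly"
  assumes char: "CHAR('f) = 0" and irr: "irreducible_module (Ah h) V"
    and max: "maximalideal (PIdl\<^bsub>polyR\<^esub> f) polyR"
    and f: "\<not> f dvd h" "\<not> f dvd pderiv f"
    and v: "v \<in> carrier V" "v \<noteq> \<zero>\<^bsub>V\<^esub>" "Ah_poly h f \<odot>\<^bsub>V\<^esub> v = \<zero>\<^bsub>V\<^esub>"
  shows "module_iso (Ah h) V (U_module h (PIdl\<^bsub>polyR\<^esub> f))"
proof -
  let ?m = "PIdl\<^bsub>polyR\<^esub> f"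
  have ideal: "ideal ?m polyR"
    using max by (rule maximalideal.axioms(1))
  interpret left_module "Ah h" V
    using irr by (simp add: irreducible_module_def)
  interpret Ah_module h V
    by unfold_locales
  interpret I: cyclic_induction polyR "Ah h" "Ah_poly h" ?m
    by (rule cyclic_induction_Ah[OF ideal])
  have ann: "p_act p v = \<zero>\<^bsub>V\<^esub>" if "p \<in> ?m" for p
    using that v p_act_dvd[of v f p] by (simp add: mem_PIdl_polyR)
  have \<theta>: "I.\<theta> (y_comb h n r) = \<zero>\<^bsub>I.U\<^esub>" if "\<And>j. j < n \<Longrightarrow> f dvd r j" for n r
    using that
  proof (induction n)
    case (Suc n)
    then show ?case
      by (simp add: y_comb_Suc I.\<theta>_add I.\<theta>_annihilates mem_PIdl_polyR)
  qed (simp add: I.\<theta>_zero)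
  have ker: "a \<odot>\<^bsub>V\<^esub> v = \<zero>\<^bsub>V\<^esub> \<longleftrightarrow> I.\<theta> a = \<zero>\<^bsub>I.U\<^esub>" if a: "a \<in> carrier (Ah h)" for a
  proof
    assume av: "a \<odot>\<^bsub>V\<^esub> v = \<zero>\<^bsub>V\<^esub>"
    obtain n r where "a = y_comb h n r"
      using a by (rule carrier_Ah_y_comb)
    with av show "I.\<theta> a = \<zero>\<^bsub>I.U\<^esub>"
      using y_comb_annihilates_imp_dvd[OF char max f v] \<theta> by blast
  qed (rule I.\<theta>_eq_zero_imp[OF left_module_axioms v(1) ann a])
  have "module_iso (Ah h) V I.U"
  proof (rule module_iso_if_same_kernel[where \<sigma> = "\<lambda>a. a \<odot>\<^bsub>V\<^esub> v" and \<tau> = I.\<theta>])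
    show "carrier V = (\<lambda>a. a \<odot>\<^bsub>V\<^esub> v) ` carrier (Ah h)"
      by (rule irreducible_module_cyclic[OF irr v(1,2)])
  qed (use v ker in \<open>simp_all add: Ah.ring_axioms left_module_axioms I.abelian_group_U smult_l_distr
      smult_assoc I.\<theta>_add I.smult_\<theta> I.carrier_U\<close>)
  then show ?thesis
    by (simp add: U_module_eq[OF ideal])
qed

text \<open>With g the generator of the annihilator of v, an element a kills v exactly when its
  polynomial over R/m is a multiple of g, and this is matched with a \<otimes> 1 lying in g
  U(m).\<close>

lemma module_iso_L_module:
  fixes h f :: "'f::field poly"
  assumes irr: "irreducible_module (Ah h) V"
    and max: "maximalideal (PIdl\<^bsub>polyR\<^esub> f) polyR"
    and f: "f dvd h" "\<And>v. v \<in> carrier V \<Longrightarrow> Ah_poly h f \<odot>\<^bsub>V\<^esub> v = \<zero>\<^bsub>V\<^esub>"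
    and v: "v \<in> carrier V" "v \<noteq> \<zero>\<^bsub>V\<^esub>"
  shows "\<exists>g. monic_prime_poly (polyR Quot (PIdl\<^bsub>polyR\<^esub> f)) g \<and>
    module_iso (Ah h) V (L_module h (PIdl\<^bsub>polyR\<^esub> f) g)"
proof -
  let ?m = "PIdl\<^bsub>polyR\<^esub> f"
  have ideal: "ideal ?m polyR"
    using max by (rule maximalideal.axioms(1))
  interpret left_module "Ah h" V
    using irr by (simp add: irreducible_module_def)
  interpret V: weight_module h V f
    by (intro weight_module.intro Ah_module.intro weight_module_axioms.intro left_module_axioms max f)
  interpret I: cyclic_induction polyR "Ah h" "Ah_poly h" ?m
    by (rule cyclic_induction_Ah[OF ideal])
  interpret U: Ah_module h I.U
    by (simp add: Ah_module_def I.left_module_U)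
  have \<theta>_eq: "I.\<theta> a = a \<odot>\<^bsub>I.U\<^esub> I.\<theta> \<one>\<^bsub>Ah h\<^esub>" if "a \<in> carrier (Ah h)" for a
    using that by (simp add: I.smult_\<theta>)
  \<comment> \<open>The generator 1 \<otimes> 1 is killed by f; as f divides h, the vectors killed
    by f form a submodule, which is therefore all of U(m).\<close>
  have "I.\<theta> \<one>\<^bsub>Ah h\<^esub> \<in> weight_space h I.U ?m"
    using I.\<theta>_annihilates[of "\<one>\<^bsub>Ah h\<^esub>" f] by (simp add: U.mem_weight_space I.smult_\<theta> mem_PIdl_polyR)
  then have "I.\<theta> a \<in> weight_space h I.U ?m" if "a \<in> carrier (Ah h)" for a
    using \<theta>_eq[OF that] submodule.smult_closed[OF U.submodule_weight_space[OF f(1)] that] by metis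
  then have "Ah_poly h f \<odot>\<^bsub>I.U\<^esub> u = \<zero>\<^bsub>I.U\<^esub>" if "u \<in> carrier I.U" for u
    using that by (auto simp: I.carrier_U U.mem_weight_space)
  then interpret U: weight_module h I.U f
    by (intro weight_module.intro U.Ah_module_axioms weight_module_axioms.intro max f(1))
  let ?K = "residue_field f"
  \<comment> \<open>A single polynomial G for both modules: the bridge between the annihilator in V
    and the submodule g U(m).\<close>
  have act: "\<exists>G\<in>carrier (poly_ring ?K).
      (\<forall>w\<in>carrier V. a \<odot>\<^bsub>V\<^esub> w = V.E.poly_act G w) \<and> (\<forall>u\<in>carrier I.U. a \<odot>\<^bsub>I.U\<^esub> u = U.E.poly_act G u)"
    if a: "a \<in> carrier (Ah h)" for a
  proof -
    obtain n r where "a = y_comb h n r"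
      using a by (rule carrier_Ah_y_comb)
    then show ?thesis
      using V.y_comb_smult U.y_comb_smult V.y_poly_closed by blast
  qed
  have "\<exists>p\<in>carrier (poly_ring ?K). V.E.poly_act p w = v" if w: "w \<in> carrier V" "w \<noteq> \<zero>\<^bsub>V\<^esub>" for w
  proof -
    obtain a where "a \<in> carrier (Ah h)" "v = a \<odot>\<^bsub>V\<^esub> w"
      using irreducible_module_cyclic[OF irr w] v(1) by blast
    then show ?thesis
      using act w(1) by metis
  qed
  then obtain g where g: "g \<in> carrier (poly_ring ?K)" "Polynomials.lead_coeff g = \<one>\<^bsub>?K\<^esub>"
      "pirreducible\<^bsub>?K\<^esub> (carrier ?K) g" "V.E.annihilator v = PIdl\<^bsub>poly_ring ?K\<^esub> g"
    using annihilator_prime_generator[OF V.field_residue_field V.E.module_endomorphism_axioms, of v] v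
    by auto
  interpret P: domain "poly_ring ?K"
    by (rule V.residue.univ_poly_is_domain[OF V.residue.carrier_is_subring])
  note V_commute = V.E.poly_act_commute[OF V.residue.domain_axioms]
  note U_commute = U.E.poly_act_commute[OF V.residue.domain_axioms]
  have gv: "V.E.poly_act g v = \<zero>\<^bsub>V\<^esub>"
    using P.cgenideal_self[OF g(1)] by (simp add: V.E.annihilator_def flip: g(4))
  let ?g = "poly_lift h ?m g"
  have g_closed: "?g \<in> carrier (Ah h)"
    unfolding poly_lift_def by (rule Ah.finsum_closed) auto
  have g_V: "?g \<odot>\<^bsub>V\<^esub> w = V.E.poly_act g w" if "w \<in> carrier V" for w
    using V.poly_lift_smult[OF that V.E.poly_ring_set[OF g(1)]] .
  have g_U: "?g \<odot>\<^bsub>I.U\<^esub> u = U.E.poly_act g u" if "u \<in> carrier I.U" for u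
    using U.poly_lift_smult[OF that U.E.poly_ring_set[OF g(1)]] .
  let ?J = "{?g \<odot>\<^bsub>I.U\<^esub> u | u. u \<in> carrier I.U}"
  have gJ: "?g \<odot>\<^bsub>I.U\<^esub> u \<in> ?J" if "u \<in> carrier I.U" for u
    using that by blast
  have "submodule ?J (Ah h) I.U"
  proof (rule U.submodule_if_closed)
    show "?J \<subseteq> carrier I.U"
      using g_closed by auto
    show "\<zero>\<^bsub>I.U\<^esub> \<in> ?J"
      using gJ[OF I.U.zero_closed] g_closed by simp
    show "x \<oplus>\<^bsub>I.U\<^esub> y \<in> ?J" if "x \<in> ?J" "y \<in> ?J" for x y
      using that g_closed gJ by (auto simp flip: U.smult_r_distr)
    \<comment> \<open>Any a acts as a polynomial and so commutes with g; thus a (g u) = g (a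
      u).\<close>
    have "a \<odot>\<^bsub>I.U\<^esub> x \<in> ?J" if a: "a \<in> carrier (Ah h)" and x: "x \<in> ?J" for a x
    proof -
      obtain u where u: "u \<in> carrier I.U" "x = ?g \<odot>\<^bsub>I.U\<^esub> u"
        using x by blast
      obtain G where G: "G \<in> carrier (poly_ring ?K)" "\<forall>u\<in>carrier I.U. a \<odot>\<^bsub>I.U\<^esub> u = U.E.poly_act G u"
        using act[OF a] by blast
      have "a \<odot>\<^bsub>I.U\<^esub> x = ?g \<odot>\<^bsub>I.U\<^esub> (a \<odot>\<^bsub>I.U\<^esub> u)"
        using u g_closed G U_commute[OF G(1) g(1), of u]
          U.E.poly_act_closed[OF U.E.poly_ring_set[OF G(1)], of u]
          U.E.poly_act_closed[OF U.E.poly_ring_set[OF g(1)], of u] by (simp add: g_U)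
      then show ?thesis
        using gJ u a by simp
    qed
    then show "Ah_poly h p \<odot>\<^bsub>I.U\<^esub> x \<in> ?J" "Ah_y h \<odot>\<^bsub>I.U\<^esub> x \<in> ?J" if "x \<in> ?J" for p x
      using that by blast+
  qed
  note quot = quot_module_facts[OF I.left_module_U this]
  have ann: "Ah_poly h p \<odot>\<^bsub>V\<^esub> v = \<zero>\<^bsub>V\<^esub>" if "p \<in> ?m" for p
    using that f(2) v V.p_act_dvd[of v f p] by (simp add: mem_PIdl_polyR)
  have ker: "a \<odot>\<^bsub>V\<^esub> v = \<zero>\<^bsub>V\<^esub> \<longleftrightarrow> I.\<theta> a \<in> ?J" if a: "a \<in> carrier (Ah h)" for a
  proof
    assume av: "a \<odot>\<^bsub>V\<^esub> v = \<zero>\<^bsub>V\<^esub>"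
    obtain G where G: "G \<in> carrier (poly_ring ?K)" "V.E.poly_act G v = a \<odot>\<^bsub>V\<^esub> v"
        "\<And>u. u \<in> carrier I.U \<Longrightarrow> a \<odot>\<^bsub>I.U\<^esub> u = U.E.poly_act G u"
      using act[OF a] v(1) by auto
    then have "G \<in> V.E.annihilator v"
      using av by (simp add: V.E.annihilator_def)
    then obtain x where x: "x \<in> carrier (poly_ring ?K)" "G = x \<otimes>\<^bsub>poly_ring ?K\<^esub> g"
      unfolding g(4) cgenideal_def by blast
    let ?u = "I.\<theta> \<one>\<^bsub>Ah h\<^esub>"
    \<comment> \<open>With G = x g, the element a \<otimes> 1 is G applied to 1 \<otimes> 1, that
      is, g applied to x (1 \<otimes> 1).\<close>
    have "I.\<theta> a = U.E.poly_act G ?u"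
      using \<theta>_eq[OF a] G(3) by simp
    also have "\<dots> = U.E.poly_act g (U.E.poly_act x ?u)"
      using U.E.poly_act_mult[OF g(1) x(1), of ?u] x g(1) P.m_comm[OF x(1) g(1)] by simp
    also have "\<dots> = ?g \<odot>\<^bsub>I.U\<^esub> (U.E.poly_act x ?u)"
      using U.E.poly_act_closed[OF U.E.poly_ring_set[OF x(1)], of ?u] by (simp add: g_U)
    finally show "I.\<theta> a \<in> ?J"
      using gJ U.E.poly_act_closed[OF U.E.poly_ring_set[OF x(1)], of ?u] by simp
  next
    assume "I.\<theta> a \<in> ?J"
    then obtain b where b: "b \<in> carrier (Ah h)" "I.\<theta> a = I.\<theta> (?g \<otimes>\<^bsub>Ah h\<^esub> b)"
      using g_closed by (auto simp: I.carrier_U I.smult_\<theta>)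
    obtain G where G: "G \<in> carrier (poly_ring ?K)" "b \<odot>\<^bsub>V\<^esub> v = V.E.poly_act G v"
      using act[OF b(1)] v(1) by blast
    have "a \<odot>\<^bsub>V\<^esub> v = (?g \<otimes>\<^bsub>Ah h\<^esub> b) \<odot>\<^bsub>V\<^esub> v"
      using a b g_closed by (intro I.\<theta>_eq_imp[OF left_module_axioms v(1) ann]) auto
    also have "\<dots> = V.E.poly_act g (V.E.poly_act G v)"
      using g_closed b v smult_closed[of b v] by (simp add: smult_assoc g_V G(2)[symmetric])
    also have "\<dots> = V.E.poly_act G (V.E.poly_act g v)"
      using V_commute[OF g(1) G(1)] v(1) by simp
    \<comment> \<open>The zero vector is written as the zero polynomial acting on v, so that
      commutation removes G.\<close>
    also have "\<dots> = V.E.poly_act G (V.E.poly_act [] v)"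
      by (simp add: gv)
    also have "\<dots> = V.E.poly_act [] (V.E.poly_act G v)"
      using V_commute[OF G(1) P.zero_closed] v(1) by (simp add: univ_poly_zero)
    finally show "a \<odot>\<^bsub>V\<^esub> v = \<zero>\<^bsub>V\<^esub>"
      by simp
  qed
  have "module_iso (Ah h) V (quot_module I.U ?J)"
  proof (rule module_iso_if_same_kernel[where \<sigma> = "\<lambda>a. a \<odot>\<^bsub>V\<^esub> v" and \<tau> = "\<lambda>a. ?J +>\<^bsub>I.U\<^esub> I.\<theta> a"])
    show "carrier V = (\<lambda>a. a \<odot>\<^bsub>V\<^esub> v) ` carrier (Ah h)"
      by (rule irreducible_module_cyclic[OF irr v(1,2)])
    show "carrier (quot_module I.U ?J) = (\<lambda>a. ?J +>\<^bsub>I.U\<^esub> I.\<theta> a) ` carrier (Ah h)"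
      unfolding quot(2) unfolding I.carrier_U by (simp add: image_image)
    show "?J +>\<^bsub>I.U\<^esub> I.\<theta> (a \<oplus>\<^bsub>Ah h\<^esub> b) =
        (?J +>\<^bsub>I.U\<^esub> I.\<theta> a) \<oplus>\<^bsub>quot_module I.U ?J\<^esub> (?J +>\<^bsub>I.U\<^esub> I.\<theta> b)"
      if "a \<in> carrier (Ah h)" "b \<in> carrier (Ah h)" for a b
      using quot(3)[OF I.\<theta>_closed I.\<theta>_closed] that by (simp add: I.\<theta>_add)
    show "?J +>\<^bsub>I.U\<^esub> I.\<theta> (a \<otimes>\<^bsub>Ah h\<^esub> b) = a \<odot>\<^bsub>quot_module I.U ?J\<^esub> (?J +>\<^bsub>I.U\<^esub> I.\<theta> b)"
      if "a \<in> carrier (Ah h)" "b \<in> carrier (Ah h)" for a b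
      using quot(4)[OF _ I.\<theta>_closed] that by (simp add: I.smult_\<theta>)
    show "a \<odot>\<^bsub>V\<^esub> v = \<zero>\<^bsub>V\<^esub> \<longleftrightarrow> ?J +>\<^bsub>I.U\<^esub> I.\<theta> a = \<zero>\<^bsub>quot_module I.U ?J\<^esub>"
      if "a \<in> carrier (Ah h)" for a
      using quot(5)[OF I.\<theta>_closed] ker that by simp
  qed (use v quot(1) in \<open>simp_all add: Ah.ring_axioms left_module_axioms smult_l_distr smult_assoc\<close>)
  moreover have "L_module h ?m g = quot_module I.U ?J"
    by (simp add: L_module_def gU_submodule_def U_module_eq[OF ideal])
  moreover have "monic_prime_poly (polyR Quot ?m) g"
    using g by (simp add: monic_prime_poly_def residue_field_def)
  ultimately show ?thesis
    by metis
qed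

theorem corollary6p1:
  fixes h :: "'f::field_char_0 poly"
    and V :: "('f free_alg set, 'v) module"
  assumes "h \<noteq> 0"
    and "irreducible_module (Ah h) V"
    and "generalized_weight_module h V"
  shows "\<exists>m f. maximalideal m polyR \<and> Factorial_Ring.irreducible f \<and> m = PIdl\<^bsub>polyR\<^esub> f \<and>
    carrier V = gen_weight_space h V m \<and>
    (f dvd h \<longrightarrow>
      carrier V = weight_space h V m \<and>
      (\<exists>G. monic_prime_poly (polyR Quot m) G \<and> module_iso (Ah h) V (L_module h m G))) \<and>
    (\<not> f dvd h \<longrightarrow> module_iso (Ah h) V (U_module h m))"
proof -
  obtain f v where max: "maximalideal (PIdl\<^bsub>polyR\<^esub> f) polyR"
    and V: "carrier V = gen_weight_space h V (PIdl\<^bsub>polyR\<^esub> f)"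
    and v: "v \<in> carrier V" "v \<noteq> \<zero>\<^bsub>V\<^esub>" "Ah_poly h f \<odot>\<^bsub>V\<^esub> v = \<zero>\<^bsub>V\<^esub>"
    using irreducible_gen_weight_module[OF assms(2,3)] .
  interpret Ah_module h V
    using assms(2) by (simp add: Ah_module_def irreducible_module_def)
  have f: "Factorial_Ring.irreducible f"
    using max by (rule maximalideal_polyR_irreducible)
  \<comment> \<open>The single vector v makes this submodule nonzero, hence all of V.\<close>
  have weight: "carrier V = weight_space h V (PIdl\<^bsub>polyR\<^esub> f)" if "f dvd h"
  proof -
    have "v \<in> weight_space h V (PIdl\<^bsub>polyR\<^esub> f)"
      using v by (simp add: mem_weight_space)
    then show ?thesis
      using assms(2) submodule_weight_space[OF that] v(2) unfolding irreducible_module_def by blast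
  qed
  \<comment> \<open>The open premise \<open>CHAR('f) = 0\<close> is what the type class
    \<open>field_char_0\<close> provides.\<close>
  have "module_iso (Ah h) V (U_module h (PIdl\<^bsub>polyR\<^esub> f))" if "\<not> f dvd h"
    using module_iso_U_module[OF _ assms(2) max that irreducible_not_dvd_pderiv[OF f] v] by simp
  moreover have "\<exists>G. monic_prime_poly (polyR Quot (PIdl\<^bsub>polyR\<^esub> f)) G \<and>
      module_iso (Ah h) V (L_module h (PIdl\<^bsub>polyR\<^esub> f) G)" if "f dvd h"
  proof (rule module_iso_L_module[OF assms(2) max that _ v(1,2)])
    show "Ah_poly h f \<odot>\<^bsub>V\<^esub> w = \<zero>\<^bsub>V\<^esub>" if w: "w \<in> carrier V" for w
    proof -
      have "w \<in> weight_space h V (PIdl\<^bsub>polyR\<^esub> f)"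
        using w weight[OF \<open>f dvd h\<close>] by simp
      then show ?thesis
        by (simp add: mem_weight_space)
    qed
  qed
  ultimately show ?thesis
    using max f V weight by blast
qed

end
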